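(* Define the integers $a_n$ ($n\ge0$) by $\prod_{n=1}^{\infty}(1-w^n)=\sum_{n=0}^{\infty}a_n w^n$ for $|w|<1$, and for $1/4<s<1/2$ define, for functions $g$ on $\mathbb{Z}$, \[ \mathcal{I}_{s,f}\,g(m)=\sum_{n=1}^{\infty}\frac{a_n}{n^s}\,g(m-n),\qquad m\in\mathbb{Z}. \] If $1<p\le 2\le q<\infty$ and \[ \frac1q\le\frac1p-\frac12+s, \] then there is a constant $C$ such that $\|\mathcal{I}_{s,f}\,g\|_{\ell^q(\mathbb{Z})}\le C\|g\|_{\ell^p(\mathbb{Z})}$ for all $g\in\ell^p(\mathbb{Z})$.
   Context: $\ell^p(\mathbb{Z})$ is the space of functions $g$ on $\mathbb{Z}$ with $\|g\|_{\ell^p}=(\sum_{m\in\mathbb{Z}}|g(m)|^p)^{1/p}<\infty$. By Euler's pentagonal number theorem, $a_n\in\{0,\pm1\}$ and $a_n\neq 0$ only for $n=(3k^2+k)/2$, $k\in\mathbb{Z}$. *)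

theory Defs
  imports "HOL-Analysis.Analysis"
begin

definition euler_coeff :: "nat \<Rightarrow> int" where
  "euler_coeff = (THE a. \<forall>w::complex. norm w < 1 \<longrightarrow>
      (\<lambda>n. of_int (a n) * w ^ n) sums (\<Prod>k. (1 - w ^ Suc k)))"

definition in_lp :: "real \<Rightarrow> (int \<Rightarrow> complex) \<Rightarrow> bool" where
  "in_lp p g \<longleftrightarrow> (\<lambda>m. norm (g m) powr p) summable_on (UNIV :: int set)"

definition lp_norm :: "real \<Rightarrow> (int \<Rightarrow> complex) \<Rightarrow> real" where
  "lp_norm p g = (\<Sum>\<^sub>\<infinity>m\<in>(UNIV :: int set). norm (g m) powr p) powr (1 / p)"

definition I_sf :: "real \<Rightarrow> (int \<Rightarrow> complex) \<Rightarrow> int \<Rightarrow> complex" where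
  "I_sf s g m = (\<Sum>n. of_real (real_of_int (euler_coeff (Suc n)) / real (Suc n) powr s)
                       * g (m - int (Suc n)))"

end

theory Submission
  imports Defs "HOL-Complex_Analysis.Complex_Analysis"
begin

text \<open>
  Since \<open>p \<le> 2 \<le> q\<close>, the inclusions of \<open>\<ell>\<^sup>p\<close> in \<open>\<ell>\<^sup>2\<close> and of \<open>\<ell>\<^sup>2\<close> in \<open>\<ell>\<^sup>q\<close> reduce the claim to
  boundedness on \<open>\<ell>\<^sup>2\<close>, that is, by Parseval's identity, to boundedness of \<open>\<Sum>n\<ge>1. a\<^sub>n n\<^sup>-\<^sup>s z\<^sup>n\<close> on the
  open unit disc. Writing \<open>\<Gamma>(s) n\<^sup>-\<^sup>s\<close> as the integral of \<open>y\<^sup>s\<^sup>-\<^sup>1 e\<^sup>-\<^sup>n\<^sup>y\<close> over \<open>y > 0\<close>, this follows for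
  \<open>s > 1/4\<close> from the bound \<open>O((1 - \<bar>z\<bar>)\<^sup>-\<^sup>1\<^sup>/\<^sup>4)\<close> for the Euler product, that is, from the fact that
  \<open>Im \<tau> * \<bar>\<eta> \<tau>\<bar>\<^sup>4\<close> is bounded on the upper half plane.

  That function is invariant under \<open>\<tau> \<mapsto> \<tau> + 1\<close> and \<open>\<tau> \<mapsto> -1/\<tau>\<close>. As long as \<open>Im \<tau> < 1/2\<close>, translating
  to \<open>\<bar>Re \<tau>\<bar> \<le> 1/2\<close> and then inverting at least doubles \<open>Im \<tau>\<close>, so only \<open>Im \<tau> \<ge> 1/2\<close> has to be
  considered, where the bound is trivial. Invariance under inversion comes from the theta product:
  the quotient of \<open>exp (- \<pi> i x\<^sup>2 / \<tau>) \<theta>(x/\<tau>; -1/\<tau>)\<close> and \<open>\<theta>(x; \<tau>)\<close> is an elliptic function without poles,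
  hence a constant. Its limit at \<open>x = 0\<close> contains the quotient of the two eta values, while its absolute
  value is found by multiplying its values at the three half periods, where the products cancel.
\<close>

subsection \<open>The q-Pochhammer symbol\<close>

definition qprod :: "complex \<Rightarrow> complex \<Rightarrow> complex" where
  "qprod a q = (\<Prod>n. 1 - a * q ^ n)"

lemma convergent_prod_qprod:
  fixes a q :: complex
  assumes "norm q < 1"
  shows "convergent_prod (\<lambda>n. 1 - a * q ^ n)"
proof (rule abs_convergent_prod_imp_convergent_prod)
  have "summable (\<lambda>n. norm a * norm q ^ n)"
    using assms by (intro summable_mult summable_geometric) auto
  then show "abs_convergent_prod (\<lambda>n. 1 - a * q ^ n)"
    by (simp add: abs_convergent_prod_conv_summable norm_mult norm_power)
qed

lemma has_prod_qprod: "norm q < 1 \<Longrightarrow> (\<lambda>n. 1 - a * q ^ n) has_prod qprod a q"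
  using convergent_prod_qprod convergent_prod_has_prod unfolding qprod_def by blast

lemma LIMSEQ_qprod:
  assumes "norm q < 1"
  shows "(\<lambda>n. \<Prod>k<n. 1 - a * q ^ k) \<longlonglongrightarrow> qprod a q"
  using has_prod_imp_tendsto'[OF has_prod_qprod[OF assms]] .

lemma qprod_eq_0_iff: "norm q < 1 \<Longrightarrow> qprod a q = 0 \<longleftrightarrow> (\<exists>n. a * q ^ n = 1)"
  using has_prod_eq_0_iff[OF has_prod_qprod] by (fastforce simp: image_iff)

lemma qprod_rec:
  assumes "norm q < 1"
  shows "qprod a q = (1 - a) * qprod (a * q) q"
proof (rule LIMSEQ_unique)
  show "(\<lambda>n. \<Prod>k<Suc n. 1 - a * q ^ k) \<longlonglongrightarrow> qprod a q"
    using LIMSEQ_qprod[OF assms] by (rule LIMSEQ_Suc)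
  have "(\<Prod>k<Suc n. 1 - a * q ^ k) = (1 - a) * (\<Prod>k<n. 1 - a * q * q ^ k)" for n
    by (simp add: prod.lessThan_Suc_shift mult.assoc del: prod.lessThan_Suc)
  then show "(\<lambda>n. \<Prod>k<Suc n. 1 - a * q ^ k) \<longlonglongrightarrow> (1 - a) * qprod (a * q) q"
    using tendsto_mult[OF tendsto_const LIMSEQ_qprod[OF assms]] by simp
qed

lemma norm_qprod_le:
  assumes "norm q < 1"
  shows "norm (qprod a q) \<le> exp (norm a / (1 - norm q))"
proof (rule LIMSEQ_le_const2[OF tendsto_norm[OF LIMSEQ_qprod[OF assms]]])
  have "norm (\<Prod>k<n. 1 - a * q ^ k) \<le> exp (norm a / (1 - norm q))" for n
  proof -
    have "norm (\<Prod>k<n. 1 - a * q ^ k) \<le> (\<Prod>k<n. 1 + norm a * norm q ^ k)"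
      unfolding prod_norm[symmetric]
      by (intro prod_mono) (auto intro: order.trans[OF norm_triangle_ineq4] simp: norm_mult norm_power)
    also have "\<dots> \<le> exp (\<Sum>k<n. norm a * norm q ^ k)"
      by (rule prod_le_exp_sum) auto
    also have "(\<Sum>k<n. norm a * norm q ^ k) \<le> (\<Sum>k. norm a * norm q ^ k)"
      using assms by (intro sum_le_suminf summable_mult summable_geometric) auto
    also have "(\<Sum>k. norm a * norm q ^ k) = norm a / (1 - norm q)"
      using assms by (simp add: suminf_mult suminf_geometric)
    finally show ?thesis by simp
  qed
  then show "\<exists>N. \<forall>n\<ge>N. norm (\<Prod>k<n. 1 - a * q ^ k) \<le> exp (norm a / (1 - norm q))"
    by blast
qed

lemma uniform_limit_qprod:
  fixes f g :: "complex \<Rightarrow> complex"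
  assumes "compact K" "continuous_on K f" "continuous_on K g" "\<And>x. x \<in> K \<Longrightarrow> norm (g x) < 1"
  shows "uniform_limit K (\<lambda>n x. \<Prod>k<n. 1 - f x * g x ^ k) (\<lambda>x. qprod (f x) (g x)) sequentially"
proof (cases "K = {}")
  case False
  obtain M where M: "\<And>x. x \<in> K \<Longrightarrow> norm (f x) \<le> M"
    using compact_imp_bounded[OF compact_continuous_image[OF assms(2,1)]]
    by (auto simp: bounded_iff)
  obtain x0 where x0: "x0 \<in> K" "\<And>x. x \<in> K \<Longrightarrow> norm (g x) \<le> norm (g x0)"
    using continuous_attains_sup[OF assms(1) False continuous_on_norm[OF assms(3)]] by blast
  have "uniformly_convergent_on K (\<lambda>N x. \<Sum>n<N. norm (f x * g x ^ n))"
  proof (rule Weierstrass_m_test'_ev[OF always_eventually])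
    show "\<forall>n. \<forall>x\<in>K. norm (norm (f x * g x ^ n)) \<le> M * norm (g x0) ^ n"
      using M x0 order_trans[OF norm_ge_zero M[OF x0(1)]]
      by (auto simp: norm_mult norm_power intro!: mult_mono power_mono)
    show "summable (\<lambda>n. M * norm (g x0) ^ n)"
      using assms(4)[OF x0(1)] by (intro summable_mult summable_geometric) auto
  qed
  then have "uniformly_convergent_on K (\<lambda>n x. \<Prod>k<n. 1 - f x * g x ^ k)"
    by (intro uniformly_convergent_on_prod') (auto intro!: continuous_intros assms)
  then obtain l where l: "uniform_limit K (\<lambda>n x. \<Prod>k<n. 1 - f x * g x ^ k) l sequentially"
    by (auto simp: uniformly_convergent_on_def)
  have "l x = qprod (f x) (g x)" if "x \<in> K" for x
    using LIMSEQ_unique[OF tendsto_uniform_limitI[OF l that] LIMSEQ_qprod] assms(4)[OF that] by blast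
  with l show ?thesis
    by (metis (mono_tags, lifting) uniform_limit_cong')
qed auto

lemma holomorphic_on_qprod:
  assumes "open S" "f holomorphic_on S" "g holomorphic_on S" "\<And>x. x \<in> S \<Longrightarrow> norm (g x) < 1"
  shows "(\<lambda>x. qprod (f x) (g x)) holomorphic_on S"
proof (rule holomorphic_uniform_sequence[OF assms(1)])
  show "(\<lambda>x. \<Prod>k<n. 1 - f x * g x ^ k) holomorphic_on S" for n
    by (intro holomorphic_intros assms)
  fix x assume "x \<in> S"
  then obtain d where d: "d > 0" "cball x d \<subseteq> S"
    using assms(1) open_contains_cball by blast
  then have "uniform_limit (cball x d) (\<lambda>n x. \<Prod>k<n. 1 - f x * g x ^ k) (\<lambda>x. qprod (f x) (g x)) sequentially"
    by (intro uniform_limit_qprod)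
      (auto intro!: assms(4) holomorphic_on_imp_continuous_on holomorphic_on_subset[OF assms(2)]
        holomorphic_on_subset[OF assms(3)])
  with d show "\<exists>d>0. cball x d \<subseteq> S \<and>
      uniform_limit (cball x d) (\<lambda>n x. \<Prod>k<n. 1 - f x * g x ^ k) (\<lambda>x. qprod (f x) (g x)) sequentially"
    by blast
qed

lemma norm_power_less_one: "norm (q :: complex) < 1 \<Longrightarrow> 0 < n \<Longrightarrow> norm (q ^ n) < 1"
  by (simp add: norm_power power_less_one_iff)

lemma qprod_nonzero:
  assumes "norm q < 1" "norm a < 1"
  shows "qprod a q \<noteq> 0"
proof
  assume "qprod a q = 0"
  then obtain n where n: "a * q ^ n = 1"
    using assms by (auto simp: qprod_eq_0_iff)
  have "norm (a * q ^ n) \<le> norm a * 1"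
    unfolding norm_mult norm_power using assms by (intro mult_left_mono power_le_one) auto
  with n assms show False by simp
qed

lemma qprod_mult_qprod_uminus:
  assumes "norm q < 1"
  shows "qprod a q * qprod (- a) q = qprod (a\<^sup>2) (q\<^sup>2)"
proof (rule LIMSEQ_unique)
  have "(\<Prod>k<n. 1 - a * q ^ k) * (\<Prod>k<n. 1 - (- a) * q ^ k) = (\<Prod>k<n. 1 - a\<^sup>2 * (q\<^sup>2) ^ k)" for n
    unfolding prod.distrib[symmetric]
    by (intro prod.cong) (auto simp: algebra_simps power2_eq_square power_mult_distrib)
  then show "(\<lambda>n. \<Prod>k<n. 1 - a\<^sup>2 * (q\<^sup>2) ^ k) \<longlonglongrightarrow> qprod a q * qprod (- a) q"
    using tendsto_mult[OF LIMSEQ_qprod[OF assms] LIMSEQ_qprod[OF assms], of a "- a"] by simp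
  show "(\<lambda>n. \<Prod>k<n. 1 - a\<^sup>2 * (q\<^sup>2) ^ k) \<longlonglongrightarrow> qprod (a\<^sup>2) (q\<^sup>2)"
    using assms by (intro LIMSEQ_qprod norm_power_less_one) auto
qed

lemma qprod_even_odd:
  assumes "norm q < 1"
  shows "qprod a q = qprod a (q\<^sup>2) * qprod (a * q) (q\<^sup>2)"
proof (rule LIMSEQ_unique)
  have split: "(\<Prod>k<2 * n. 1 - a * q ^ k)
    = (\<Prod>k<n. 1 - a * (q\<^sup>2) ^ k) * (\<Prod>k<n. 1 - a * q * (q\<^sup>2) ^ k)" for n
    by (induction n) (simp_all add: algebra_simps power_mult[symmetric])
  show "(\<lambda>n. \<Prod>k<2 * n. 1 - a * q ^ k) \<longlonglongrightarrow> qprod a q"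
    using LIMSEQ_subseq_LIMSEQ[OF LIMSEQ_qprod[OF assms], of "\<lambda>n. 2 * n"]
    by (simp add: strict_mono_def o_def)
  show "(\<lambda>n. \<Prod>k<2 * n. 1 - a * q ^ k) \<longlonglongrightarrow> qprod a (q\<^sup>2) * qprod (a * q) (q\<^sup>2)"
    unfolding split using assms by (intro tendsto_mult LIMSEQ_qprod norm_power_less_one) auto
qed

lemma qprod_half_periods:
  assumes "norm h < 1" "q = h\<^sup>2"
  shows "qprod (- q) q * qprod h q * qprod (- h) q = 1"
proof -
  have q: "norm q < 1" "norm (q\<^sup>2) < 1"
    using assms by (auto intro!: norm_power_less_one)
  have "qprod (- q) q * (qprod h q * qprod (- h) q) * qprod (q\<^sup>2) (q\<^sup>2)
      = qprod (- q) q * (qprod q (q\<^sup>2) * qprod (q * q) (q\<^sup>2))"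
    using qprod_mult_qprod_uminus[OF q(1), of h] assms(2) by (simp add: power2_eq_square)
  also have "\<dots> = qprod q q * qprod (- q) q"
    using qprod_even_odd[OF q(1), of q] by simp
  also have "\<dots> = qprod (q\<^sup>2) (q\<^sup>2)"
    by (rule qprod_mult_qprod_uminus[OF q(1)])
  finally show ?thesis
    using qprod_nonzero[OF q(2) q(2)] by (simp add: mult.assoc)
qed

subsection \<open>The exponential with period one\<close>

definition exp2pi :: "complex \<Rightarrow> complex" where
  "exp2pi z = exp (2 * of_real pi * \<i> * z)"

lemma exp2pi_add: "exp2pi (a + b) = exp2pi a * exp2pi b"
  by (simp add: exp2pi_def exp_add ring_distribs)

lemma exp2pi_diff: "exp2pi (a - b) = exp2pi a / exp2pi b"
  by (simp add: exp2pi_def exp_diff ring_distribs)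

lemma exp2pi_nonzero [simp]: "exp2pi a \<noteq> 0"
  by (simp add: exp2pi_def)

lemma exp2pi_0 [simp]: "exp2pi 0 = 1"
  by (simp add: exp2pi_def)

lemma exp2pi_of_nat_mult: "exp2pi (of_nat n * a) = exp2pi a ^ n"
  unfolding exp2pi_def by (subst exp_of_nat_mult[symmetric]) (simp add: algebra_simps)

lemma exp2pi_eq_1_iff: "exp2pi z = 1 \<longleftrightarrow> (\<exists>n::int. z = of_int n)"
proof -
  have "exp2pi z = 1 \<longleftrightarrow> Im z = 0 \<and> (\<exists>n::int. Re z = of_int n)"
    by (auto simp: exp2pi_def exp_eq_1)
  then show ?thesis
    by (auto simp: complex_eq_iff)
qed

lemma exp2pi_1 [simp]: "exp2pi 1 = 1"
  using exp2pi_eq_1_iff[of 1] by (metis of_int_1)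

lemma exp2pi_half [simp]: "exp2pi (1 / 2) = - 1"
  by (simp add: exp2pi_def)

lemma norm_exp2pi: "norm (exp2pi z) = exp (- 2 * pi * Im z)"
  by (simp add: exp2pi_def)

lemma norm_exp2pi_less_1 [simp]: "Im z > 0 \<Longrightarrow> norm (exp2pi z) < 1"
  by (simp add: norm_exp2pi)

lemma holomorphic_on_exp2pi [holomorphic_intros]:
  "f holomorphic_on A \<Longrightarrow> (\<lambda>x. exp2pi (f x)) holomorphic_on A"
  unfolding exp2pi_def by (intro holomorphic_intros)

lemma exp2pi_of_int [simp]: "exp2pi (of_int n) = 1"
  by (auto simp: exp2pi_eq_1_iff)

subsection \<open>Elliptic functions\<close>

definition lattice :: "complex \<Rightarrow> complex set" where
  "lattice \<tau> = {x. \<exists>m n::int. x = of_int m + of_int n * \<tau>}"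

lemma latticeI [intro]: "of_int m + of_int n * \<tau> \<in> lattice \<tau>"
  by (auto simp: lattice_def)

lemma latticeE [elim]:
  assumes "x \<in> lattice \<tau>"
  obtains m n :: int where "x = of_int m + of_int n * \<tau>"
  using assms by (auto simp: lattice_def)

lemma zero_in_lattice [simp]: "0 \<in> lattice \<tau>"
  using latticeI[of 0 0] by simp

lemma one_in_lattice [simp]: "1 \<in> lattice \<tau>"
  using latticeI[of 1 0] by simp

lemma period_in_lattice [simp]: "\<tau> \<in> lattice \<tau>"
  using latticeI[of 0 1] by simp

lemma lattice_diff:
  assumes "x \<in> lattice \<tau>" "y \<in> lattice \<tau>"
  shows "x - y \<in> lattice \<tau>"
proof -
  obtain m n k l :: int where "x = of_int m + of_int n * \<tau>" "y = of_int k + of_int l * \<tau>"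
    using assms by (elim latticeE)
  then have "x - y = of_int (m - k) + of_int (n - l) * \<tau>"
    by (simp add: algebra_simps)
  then show ?thesis
    by (simp only: latticeI)
qed

lemma lattice_add_iff:
  assumes "w \<in> lattice \<tau>"
  shows "x + w \<in> lattice \<tau> \<longleftrightarrow> x \<in> lattice \<tau>"
  using lattice_diff[of "x + w" \<tau> w] lattice_diff[of x \<tau> "0 - w"] lattice_diff[of 0 \<tau> w] assms by auto

lemma lattice_period:
  fixes f :: "complex \<Rightarrow> 'a"
  assumes "\<And>x. f (x + 1) = f x" "\<And>x. f (x + \<tau>) = f x" "w \<in> lattice \<tau>"
  shows "f (x + w) = f x"
proof -
  have period_int: "f (x + of_int n * \<omega>) = f x" if \<omega>: "\<And>x. f (x + \<omega>) = f x" for x \<omega> and n :: int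
  proof (induction n rule: int_induct[where k = 0])
    case (step1 i)
    then show ?case using \<omega>[of "x + of_int i * \<omega>"] by (simp add: algebra_simps)
  next
    case (step2 i)
    then show ?case using \<omega>[of "x + of_int (i - 1) * \<omega>"] by (simp add: algebra_simps)
  qed auto
  obtain m n :: int where "w = of_int m * 1 + of_int n * \<tau>"
    using assms(3) by auto
  then show ?thesis
    using period_int[of 1, OF assms(1)] period_int[of \<tau>, OF assms(2)] by (simp add: add.assoc[symmetric])
qed

lemma norm_lattice_ge:
  assumes "Im \<tau> > 0" "x \<in> lattice \<tau>" "x \<noteq> 0"
  shows "min 1 (Im \<tau>) \<le> norm x"
proof -
  obtain m n :: int where x: "x = of_int m + of_int n * \<tau>"
    using assms(2) by auto
  show ?thesis
  proof (cases "n = 0")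
    case True
    then show ?thesis
      using assms(3) x by (simp add: norm_of_int min.coboundedI1)
  next
    case False
    have "Im \<tau> * 1 \<le> Im \<tau> * \<bar>of_int n\<bar>"
      using False assms(1) by (intro mult_left_mono) auto
    also have "\<dots> = \<bar>Im x\<bar>"
      using assms(1) by (simp add: x abs_mult)
    also have "\<dots> \<le> norm x"
      by (rule abs_Im_le_cmod)
    finally show ?thesis
      by simp
  qed
qed

lemma closed_lattice:
  assumes "Im \<tau> > 0"
  shows "closed (lattice \<tau>)"
proof (rule discrete_imp_closed)
  show "\<forall>x\<in>lattice \<tau>. \<forall>y\<in>lattice \<tau>. dist y x < min 1 (Im \<tau>) \<longrightarrow> y = x"
    using norm_lattice_ge[OF assms lattice_diff] by (fastforce simp: dist_norm)
qed (use assms in simp)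

lemma lattice_translate_to_fundamental_parallelogram:
  assumes "Im \<tau> > 0"
  obtains w u v where "w \<in> lattice \<tau>" "u \<in> {0..1}" "v \<in> {0..1}" "x = of_real u + of_real v * \<tau> + w"
proof -
  define v where "v = Im x / Im \<tau>"
  define u where "u = Re x - v * Re \<tau>"
  have "x = of_real u + of_real v * \<tau>"
    using assms by (simp add: complex_eq_iff u_def v_def)
  then have "x = of_real (frac u) + of_real (frac v) * \<tau> + (of_int \<lfloor>u\<rfloor> + of_int \<lfloor>v\<rfloor> * \<tau>)"
    by (simp add: frac_def algebra_simps)
  with that[OF latticeI, of "frac u" "frac v"] show thesis
    by (auto simp: less_imp_le[OF frac_lt_1])
qed

lemma elliptic_entire_constant:
  fixes f :: "complex \<Rightarrow> complex"
  assumes hol: "f holomorphic_on UNIV" and \<tau>: "Im \<tau> > 0"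
    and per: "\<And>x. f (x + 1) = f x" "\<And>x. f (x + \<tau>) = f x"
  shows "f constant_on UNIV"
proof (rule Liouville_theorem[OF hol])
  define P where "P = (\<lambda>(u, v). complex_of_real u + of_real v * \<tau>) ` ({0..1} \<times> {0..1})"
  have "range f \<subseteq> f ` P"
  proof safe
    fix x
    obtain w u v where "w \<in> lattice \<tau>" "u \<in> {0..1}" "v \<in> {0..1}" "x = of_real u + of_real v * \<tau> + w"
      by (rule lattice_translate_to_fundamental_parallelogram[OF \<tau>])
    then have "f x = f (of_real u + of_real v * \<tau>)" "of_real u + of_real v * \<tau> \<in> P"
      using lattice_period[where f = f, OF per] by (auto simp: P_def)
    then show "f x \<in> f ` P"
      by blast
  qed
  moreover have "compact P"
    unfolding P_def case_prod_unfold
    by (intro compact_continuous_image continuous_intros compact_Times compact_Icc)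
  then have "compact (f ` P)"
    using hol by (intro compact_continuous_image holomorphic_on_imp_continuous_on)
      (auto intro: holomorphic_on_subset)
  ultimately show "bounded (range f)"
    by (meson bounded_subset compact_imp_bounded)
qed

lemma elliptic_removable_singularities:
  fixes f :: "complex \<Rightarrow> complex"
  assumes \<tau>: "Im \<tau> > 0" and hol: "f holomorphic_on - lattice \<tau>" and lim: "(f \<longlongrightarrow> c) (at 0)"
  defines "F \<equiv> \<lambda>y. if y \<in> lattice \<tau> then c else f y"
  assumes per: "\<And>x. F (x + 1) = F x" "\<And>x. F (x + \<tau>) = F x"
  shows "F holomorphic_on UNIV"
proof -
  define \<delta> where "\<delta> = min 1 (Im \<tau>)"
  have \<delta>: "\<delta> > 0"
    using \<tau> by (simp add: \<delta>_def)
  have lattice_near_0: "y \<in> lattice \<tau> \<longleftrightarrow> y = 0" if "y \<in> ball 0 \<delta>" for y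
    using norm_lattice_ge[OF \<tau>, of y] that by (cases "y = 0") (auto simp: \<delta>_def)
  have "f holomorphic_on ball 0 \<delta> - {0}"
    by (rule holomorphic_on_subset[OF hol]) (use lattice_near_0 in blast)
  from removable_singularity[OF this open_ball lim] have F_0: "F holomorphic_on ball 0 \<delta>"
  proof (rule holomorphic_transform)
    show "(if y = 0 then c else f y) = F y" if "y \<in> ball 0 \<delta>" for y
      using lattice_near_0[OF that] by (simp add: F_def)
  qed
  have "F field_differentiable at z" for z
  proof (cases "z \<in> lattice \<tau>")
    case True
    have "F field_differentiable at (z - z)"
      using F_0 \<delta> by (intro holomorphic_on_imp_differentiable_at[OF F_0]) auto
    moreover have "(\<lambda>y. y - z) field_differentiable at z"
      by (intro derivative_intros)
    ultimately have "(F \<circ> (\<lambda>y. y - z)) field_differentiable at z"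
      by (intro field_differentiable_compose)
    moreover have "F \<circ> (\<lambda>y. y - z) = F"
      using lattice_period[where f = F, OF per True, of "y - z" for y] by (simp add: fun_eq_iff)
    ultimately show ?thesis
      by simp
  next
    case False
    have "F holomorphic_on - lattice \<tau>"
      by (rule holomorphic_transform[OF hol]) (simp add: F_def)
    then show ?thesis
      using False closed_lattice[OF \<tau>] by (intro holomorphic_on_imp_differentiable_at) auto
  qed
  then show ?thesis
    by (simp add: holomorphic_on_def)
qed

lemma elliptic_removable_constant:
  fixes f :: "complex \<Rightarrow> complex"
  assumes \<tau>: "Im \<tau> > 0" and hol: "f holomorphic_on - lattice \<tau>"
    and per: "\<And>x. f (x + 1) = f x" "\<And>x. f (x + \<tau>) = f x"
    and lim: "(f \<longlongrightarrow> c) (at 0)" and x: "x \<notin> lattice \<tau>"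
  shows "f x = c"
proof -
  define F where "F = (\<lambda>y. if y \<in> lattice \<tau> then c else f y)"
  have F_per: "F (y + 1) = F y" "F (y + \<tau>) = F y" for y
    by (simp_all add: F_def per lattice_add_iff)
  have "F holomorphic_on UNIV"
    using elliptic_removable_singularities[OF \<tau> hol lim] F_per by (simp add: F_def)
  from elliptic_entire_constant[OF this \<tau> F_per] have "F x = F 0"
    by (auto simp: constant_on_def)
  with x show ?thesis
    by (simp add: F_def)
qed

subsection \<open>The theta product and its inversion formula\<close>

text \<open>Up to a factor depending on \<open>\<tau>\<close> only, this is the Jacobi theta function \<open>\<theta>\<^sub>1\<close>.\<close>

definition theta_prod :: "complex \<Rightarrow> complex \<Rightarrow> complex" where
  "theta_prod x \<tau> = exp2pi (- x / 2) * qprod (exp2pi x) (exp2pi \<tau>) * qprod (exp2pi (\<tau> - x)) (exp2pi \<tau>)"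

lemma theta_prod_factor:
  assumes "Im \<tau> > 0"
  shows "theta_prod x \<tau> = (exp2pi (- x / 2) - exp2pi (x / 2))
    * (qprod (exp2pi (\<tau> + x)) (exp2pi \<tau>) * qprod (exp2pi (\<tau> - x)) (exp2pi \<tau>))"
proof -
  have "exp2pi (- x / 2) * exp2pi x = exp2pi (x / 2)"
    by (simp flip: exp2pi_add)
  then have "exp2pi (- x / 2) * (1 - exp2pi x) = exp2pi (- x / 2) - exp2pi (x / 2)"
    by (simp add: right_diff_distrib)
  moreover have "qprod (exp2pi x) (exp2pi \<tau>) = (1 - exp2pi x) * qprod (exp2pi (\<tau> + x)) (exp2pi \<tau>)"
    using qprod_rec[of "exp2pi \<tau>" "exp2pi x"] assms by (simp add: exp2pi_add mult.commute)
  ultimately show ?thesis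
    by (simp add: theta_prod_def mult.assoc[symmetric])
qed

lemma theta_prod_minus:
  assumes "Im \<tau> > 0"
  shows "theta_prod (- x) \<tau> = - theta_prod x \<tau>"
  unfolding theta_prod_factor[OF assms] by (simp add: algebra_simps)

lemma theta_prod_plus_1: "theta_prod (x + 1) \<tau> = - theta_prod x \<tau>"
proof -
  have "exp2pi (- (x + 1) / 2) = - exp2pi (- x / 2)"
    using exp2pi_diff[of "- x / 2" "1 / 2"] by (simp add: diff_divide_distrib)
  moreover have "exp2pi (\<tau> - (x + 1)) = exp2pi (\<tau> - x)"
    using exp2pi_diff[of "\<tau> - x" 1] by (simp add: algebra_simps)
  ultimately show ?thesis
    by (simp add: theta_prod_def exp2pi_add)
qed

lemma theta_prod_plus_tau:
  assumes "Im \<tau> > 0"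
  shows "theta_prod (x + \<tau>) \<tau> = - exp2pi (- \<tau> / 2 - x) * theta_prod x \<tau>"
proof -
  let ?q = "exp2pi \<tau>"
  have shift: "exp2pi (- (x + \<tau>) / 2) = exp2pi (- \<tau> / 2 - x) * exp2pi (x / 2)"
    by (simp add: field_simps flip: exp2pi_add)
  have split: "exp2pi (x / 2) * (1 - exp2pi (- x)) = exp2pi (x / 2) - exp2pi (- x / 2)"
    by (simp add: right_diff_distrib flip: exp2pi_add)
  have "qprod (exp2pi (- x)) ?q = (1 - exp2pi (- x)) * qprod (exp2pi (\<tau> - x)) ?q"
    using qprod_rec[of ?q "exp2pi (- x)"] assms by (simp add: exp2pi_add[symmetric])
  then have "theta_prod (x + \<tau>) \<tau> = exp2pi (- \<tau> / 2 - x) * (exp2pi (x / 2) * (1 - exp2pi (- x)))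
      * (qprod (exp2pi (\<tau> + x)) ?q * qprod (exp2pi (\<tau> - x)) ?q)"
    unfolding theta_prod_def shift by (simp add: add.commute mult_ac)
  then show ?thesis
    unfolding split theta_prod_factor[OF assms] by (simp add: algebra_simps)
qed

lemma theta_prod_eq_0_iff:
  assumes "Im \<tau> > 0"
  shows "theta_prod x \<tau> = 0 \<longleftrightarrow> x \<in> lattice \<tau>"
proof
  assume "theta_prod x \<tau> = 0"
  then have "(\<exists>n. exp2pi x * exp2pi \<tau> ^ n = 1) \<or> (\<exists>n. exp2pi (\<tau> - x) * exp2pi \<tau> ^ n = 1)"
    using assms by (auto simp: theta_prod_def qprod_eq_0_iff)
  then have "(\<exists>n::nat. exp2pi (x + of_nat n * \<tau>) = 1) \<or> (\<exists>n::nat. exp2pi (\<tau> - x + of_nat n * \<tau>) = 1)"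
    by (simp add: exp2pi_add exp2pi_of_nat_mult)
  then consider n :: nat and k :: int where "x + of_nat n * \<tau> = of_int k"
    | n :: nat and k :: int where "\<tau> - x + of_nat n * \<tau> = of_int k"
    by (auto simp: exp2pi_eq_1_iff)
  then show "x \<in> lattice \<tau>"
  proof cases
    case 1
    then have "x = of_int k + of_int (- int n) * \<tau>"
      by (simp add: algebra_simps)
    then show ?thesis
      by (simp only: latticeI)
  next
    case 2
    then have "x = of_int (- k) + of_int (int n + 1) * \<tau>"
      by (simp add: algebra_simps)
    then show ?thesis
      by (simp only: latticeI)
  qed
next
  assume "x \<in> lattice \<tau>"
  then have "(theta_prod (0 + x) \<tau> = 0) = (theta_prod 0 \<tau> = 0)"
    by (rule lattice_period[of "\<lambda>x. theta_prod x \<tau> = 0", rotated 2])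
      (simp_all add: theta_prod_plus_1 theta_prod_plus_tau[OF assms])
  then show "theta_prod x \<tau> = 0"
    by (simp add: theta_prod_factor[OF assms])
qed

lemma holomorphic_on_theta_prod [holomorphic_intros]:
  assumes "Im \<tau> > 0" "f holomorphic_on A" "open A"
  shows "(\<lambda>x. theta_prod (f x) \<tau>) holomorphic_on A"
  unfolding theta_prod_def using assms by (intro holomorphic_intros holomorphic_on_qprod) auto

lemma theta_prod_over_id_tendsto:
  assumes "Im \<tau> > 0"
  shows "((\<lambda>x. theta_prod x \<tau> / x) \<longlongrightarrow> - 2 * of_real pi * \<i> * qprod (exp2pi \<tau>) (exp2pi \<tau>) ^ 2) (at 0)"
proof -
  define U where "U x = qprod (exp2pi (\<tau> + x)) (exp2pi \<tau>) * qprod (exp2pi (\<tau> - x)) (exp2pi \<tau>)" for x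
  have "U holomorphic_on UNIV"
    unfolding U_def using assms by (intro holomorphic_intros holomorphic_on_qprod) auto
  then have "isCont U 0"
    using holomorphic_on_imp_continuous_on continuous_on_eq_continuous_at open_UNIV by blast
  then have U: "(U \<longlongrightarrow> U 0) (at 0)"
    by (simp add: isCont_def)
  have "((\<lambda>x. exp2pi (- x / 2) - exp2pi (x / 2)) has_field_derivative (- 2 * of_real pi * \<i>)) (at 0)"
    unfolding exp2pi_def by (auto intro!: derivative_eq_intros)
  then have "((\<lambda>x. (exp2pi (- x / 2) - exp2pi (x / 2)) / x) \<longlongrightarrow> - 2 * of_real pi * \<i>) (at 0)"
    by (simp add: has_field_derivative_iff)
  from tendsto_mult[OF this U] show ?thesis
    by (simp add: theta_prod_factor[OF assms] U_def power2_eq_square)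
qed

lemma Im_minus_inverse_pos: "Im \<tau> > 0 \<Longrightarrow> Im (- 1 / \<tau>) > 0"
  by (simp add: Im_divide field_simps sum_power2_gt_zero_iff)

definition theta_dual :: "complex \<Rightarrow> complex \<Rightarrow> complex" where
  "theta_dual x \<tau> = exp2pi (- (x\<^sup>2) / (2 * \<tau>)) * theta_prod (x / \<tau>) (- 1 / \<tau>)"

lemma theta_dual_plus_1:
  assumes \<tau>: "Im \<tau> > 0"
  shows "theta_dual (x + 1) \<tau> = - theta_dual x \<tau>"
proof -
  have [simp]: "\<tau> \<noteq> 0" using \<tau> by auto
  define t where "t = - 1 / \<tau>"
  have t: "Im t > 0"
    unfolding t_def by (rule Im_minus_inverse_pos[OF \<tau>])
  have "theta_prod (x / \<tau>) t = - exp2pi (- t / 2 - (x + 1) / \<tau>) * theta_prod ((x + 1) / \<tau>) t"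
    using theta_prod_plus_tau[OF t, of "(x + 1) / \<tau>"]
    by (simp add: t_def diff_divide_distrib add_divide_distrib)
  moreover have "exp2pi (- (x\<^sup>2) / (2 * \<tau>)) * exp2pi (- t / 2 - (x + 1) / \<tau>)
      = exp2pi (- ((x + 1)\<^sup>2) / (2 * \<tau>))"
    unfolding exp2pi_add[symmetric]
    by (rule arg_cong[of _ _ exp2pi]) (simp add: t_def field_simps power2_eq_square)
  ultimately show ?thesis
    unfolding theta_dual_def t_def[symmetric] by (simp flip: mult.assoc)
qed

lemma theta_dual_plus_tau:
  assumes \<tau>: "Im \<tau> > 0"
  shows "theta_dual (x + \<tau>) \<tau> = - exp2pi (- \<tau> / 2 - x) * theta_dual x \<tau>"
proof -
  have [simp]: "\<tau> \<noteq> 0" using \<tau> by auto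
  have "exp2pi (- \<tau> / 2 - x) * exp2pi (- (x\<^sup>2) / (2 * \<tau>)) = exp2pi (- ((x + \<tau>)\<^sup>2) / (2 * \<tau>))"
    unfolding exp2pi_add[symmetric]
    by (rule arg_cong[of _ _ exp2pi]) (simp add: field_simps power2_eq_square)
  then show ?thesis
    using theta_prod_plus_1[of "x / \<tau>" "- 1 / \<tau>"]
    by (simp add: theta_dual_def add_divide_distrib flip: mult.assoc)
qed

lemma theta_dual_lattice_eq_0:
  assumes \<tau>: "Im \<tau> > 0" and "x \<in> lattice \<tau>"
  shows "theta_dual x \<tau> = 0"
proof -
  have "(theta_dual (0 + x) \<tau> = 0) = (theta_dual 0 \<tau> = 0)"
    using assms(2) by (rule lattice_period[of "\<lambda>x. theta_dual x \<tau> = 0", rotated 2])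
      (simp_all add: theta_dual_plus_1[OF \<tau>] theta_dual_plus_tau[OF \<tau>])
  then show ?thesis
    using theta_prod_eq_0_iff[OF Im_minus_inverse_pos[OF \<tau>], of 0] by (simp add: theta_dual_def)
qed

lemma holomorphic_on_theta_dual:
  assumes "Im \<tau> > 0" "open A"
  shows "(\<lambda>x. theta_dual x \<tau>) holomorphic_on A"
  unfolding theta_dual_def using assms Im_minus_inverse_pos[OF assms(1)]
  by (intro holomorphic_intros) auto

lemma theta_dual_over_id_tendsto:
  assumes "Im \<tau> > 0"
  shows "((\<lambda>x. theta_dual x \<tau> / x) \<longlongrightarrow>
    - 2 * of_real pi * \<i> * qprod (exp2pi (- 1 / \<tau>)) (exp2pi (- 1 / \<tau>)) ^ 2 / \<tau>) (at 0)"
proof -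
  have [simp]: "\<tau> \<noteq> 0" using assms by auto
  have "filterlim (\<lambda>x. x / \<tau>) (at 0) (at 0)"
    by (rule filterlim_atI) (auto intro!: tendsto_eq_intros simp: eventually_at_filter)
  from filterlim_compose[OF theta_prod_over_id_tendsto[OF Im_minus_inverse_pos[OF assms]] this]
  have theta: "((\<lambda>x. theta_prod (x / \<tau>) (- 1 / \<tau>) / (x / \<tau>)) \<longlongrightarrow>
      - 2 * of_real pi * \<i> * qprod (exp2pi (- 1 / \<tau>)) (exp2pi (- 1 / \<tau>)) ^ 2) (at 0)" .
  have "isCont (\<lambda>x. exp2pi (- (x\<^sup>2) / (2 * \<tau>)) / \<tau>) 0"
    unfolding exp2pi_def by (intro continuous_intros) auto
  then have "((\<lambda>x. exp2pi (- (x\<^sup>2) / (2 * \<tau>)) / \<tau>) \<longlongrightarrow> 1 / \<tau>) (at 0)"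
    by (simp add: isCont_def)
  from tendsto_mult[OF this theta] show ?thesis
    by (simp add: theta_dual_def)
qed

lemma theta_inversion:
  assumes \<tau>: "Im \<tau> > 0"
  defines "c \<equiv> qprod (exp2pi (- 1 / \<tau>)) (exp2pi (- 1 / \<tau>)) ^ 2 / (\<tau> * qprod (exp2pi \<tau>) (exp2pi \<tau>) ^ 2)"
  shows "theta_dual x \<tau> = c * theta_prod x \<tau>"
proof (cases "x \<in> lattice \<tau>")
  case True
  then show ?thesis
    by (simp add: theta_dual_lattice_eq_0[OF \<tau>] theta_prod_eq_0_iff[OF \<tau>])
next
  case False
  have "theta_dual x \<tau> / theta_prod x \<tau> = c"
  proof (rule elliptic_removable_constant[where f = "\<lambda>x. theta_dual x \<tau> / theta_prod x \<tau>",
        OF \<tau> _ _ _ _ False])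
    show "(\<lambda>x. theta_dual x \<tau> / theta_prod x \<tau>) holomorphic_on - lattice \<tau>"
      using closed_lattice[OF \<tau>] \<tau>
      by (intro holomorphic_intros holomorphic_on_theta_dual) (auto simp: theta_prod_eq_0_iff)
    show "theta_dual (x + 1) \<tau> / theta_prod (x + 1) \<tau> = theta_dual x \<tau> / theta_prod x \<tau>" for x
      by (simp add: theta_dual_plus_1[OF \<tau>] theta_prod_plus_1)
    show "theta_dual (x + \<tau>) \<tau> / theta_prod (x + \<tau>) \<tau> = theta_dual x \<tau> / theta_prod x \<tau>" for x
      by (simp add: theta_dual_plus_tau[OF \<tau>] theta_prod_plus_tau[OF \<tau>])
    have "((\<lambda>x. (theta_dual x \<tau> / x) / (theta_prod x \<tau> / x)) \<longlongrightarrow>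
        (- 2 * of_real pi * \<i> * qprod (exp2pi (- 1 / \<tau>)) (exp2pi (- 1 / \<tau>)) ^ 2 / \<tau>)
        / (- 2 * of_real pi * \<i> * qprod (exp2pi \<tau>) (exp2pi \<tau>) ^ 2)) (at 0)"
      using \<tau> by (intro tendsto_divide theta_dual_over_id_tendsto theta_prod_over_id_tendsto)
        (auto simp: qprod_nonzero)
    then show "((\<lambda>x. theta_dual x \<tau> / theta_prod x \<tau>) \<longlongrightarrow> c) (at 0)"
      unfolding c_def by (rule Lim_transform_eventually[THEN tendsto_eq_rhs])
        (auto simp: eventually_at_filter)
  qed
  then show ?thesis
    using False by (simp add: theta_prod_eq_0_iff[OF \<tau>] field_simps)
qed

subsection \<open>The Dedekind eta function\<close>

definition dedekind_eta :: "complex \<Rightarrow> complex" where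
  "dedekind_eta \<tau> = exp2pi (\<tau> / 24) * qprod (exp2pi \<tau>) (exp2pi \<tau>)"

lemma norm_theta_prod_half_periods:
  assumes "Im \<tau> > 0"
  shows "norm (theta_prod (1 / 2) \<tau>) * norm (theta_prod (\<tau> / 2) \<tau>) * norm (theta_prod ((1 + \<tau>) / 2) \<tau>)
    = 2 * exp (pi * Im \<tau>)"
proof -
  let ?q = "exp2pi \<tau>" and ?h = "exp2pi (\<tau> / 2)"
  have exp_half: "exp2pi (\<tau> - 1 / 2) = - ?q" "exp2pi (\<tau> - \<tau> / 2) = ?h"
    "exp2pi ((1 + \<tau>) / 2) = - ?h" "exp2pi (\<tau> - (1 + \<tau>) / 2) = - ?h"
    using exp2pi_diff[of \<tau> "1 / 2"] exp2pi_add[of "1 / 2" "\<tau> / 2"] exp2pi_diff[of "\<tau> / 2" "1 / 2"]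
    by (simp_all add: field_simps)
  have "qprod (- 1) ?q = 2 * qprod (- ?q) ?q"
    using qprod_rec[of ?q "- 1"] assms by simp
  then have "norm (theta_prod (1 / 2) \<tau>) = 2 * (norm (qprod (- ?q) ?q))\<^sup>2"
    by (simp add: theta_prod_def exp_half norm_mult norm_exp2pi power2_eq_square)
  moreover have "norm (theta_prod (\<tau> / 2) \<tau>) = exp (pi * Im \<tau> / 2) * (norm (qprod ?h ?q))\<^sup>2"
    by (simp add: theta_prod_def exp_half norm_mult norm_exp2pi power2_eq_square)
  moreover have "norm (theta_prod ((1 + \<tau>) / 2) \<tau>) = exp (pi * Im \<tau> / 2) * (norm (qprod (- ?h) ?q))\<^sup>2"
    by (simp add: theta_prod_def exp_half norm_mult norm_exp2pi power2_eq_square)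
  moreover have "qprod (- ?q) ?q * qprod ?h ?q * qprod (- ?h) ?q = 1"
    using assms exp2pi_of_nat_mult[of 2 "\<tau> / 2"] by (intro qprod_half_periods) auto
  then have "(norm (qprod (- ?q) ?q) * norm (qprod ?h ?q) * norm (qprod (- ?h) ?q))\<^sup>2 = 1"
    by (simp flip: norm_mult)
  moreover have "exp (pi * Im \<tau> / 2) * exp (pi * Im \<tau> / 2) = exp (pi * Im \<tau>)"
    by (simp flip: exp_add)
  ultimately show ?thesis
    by (simp add: power_mult_distrib mult_ac)
qed

lemma norm_theta_dual_half_periods:
  assumes \<tau>: "Im \<tau> > 0"
  shows "norm (theta_dual (1 / 2) \<tau>) * norm (theta_dual (\<tau> / 2) \<tau>) * norm (theta_dual ((1 + \<tau>) / 2) \<tau>)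
    = 2 * exp (pi * (Im (- 1 / \<tau>) + Im \<tau>) / 2)"
proof -
  define t where "t = - 1 / \<tau>"
  have t: "Im t > 0"
    unfolding t_def by (rule Im_minus_inverse_pos[OF \<tau>])
  have [simp]: "\<tau> \<noteq> 0" using \<tau> by auto
  have arg: "1 / 2 / \<tau> = - (t / 2)" "\<tau> / 2 / \<tau> = 1 / 2" "(1 + \<tau>) / 2 / \<tau> = - ((1 + t) / 2) + 1"
    by (simp_all add: t_def field_simps)
  have exponent: "- ((1 / 2)\<^sup>2) / (2 * \<tau>) = t / 8" "- ((\<tau> / 2)\<^sup>2) / (2 * \<tau>) = - (\<tau> / 8)"
    "- (((1 + \<tau>) / 2)\<^sup>2) / (2 * \<tau>) = t / 8 - 1 / 4 - \<tau> / 8"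
    by (simp_all add: t_def field_simps power2_eq_square)
  have "norm (theta_dual (1 / 2) \<tau>) = exp (- pi * Im t / 4) * norm (theta_prod (t / 2) t)"
    unfolding theta_dual_def t_def[symmetric] arg exponent
    by (simp add: norm_mult norm_exp2pi theta_prod_minus[OF t])
  moreover have "norm (theta_dual (\<tau> / 2) \<tau>) = exp (pi * Im \<tau> / 4) * norm (theta_prod (1 / 2) t)"
    unfolding theta_dual_def t_def[symmetric] arg exponent by (simp add: norm_mult norm_exp2pi)
  moreover have "norm (theta_dual ((1 + \<tau>) / 2) \<tau>)
      = exp (pi * (Im \<tau> - Im t) / 4) * norm (theta_prod ((1 + t) / 2) t)"
    unfolding theta_dual_def t_def[symmetric] arg exponent theta_prod_plus_1
    by (simp add: norm_mult norm_exp2pi theta_prod_minus[OF t] algebra_simps)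
  ultimately have "norm (theta_dual (1 / 2) \<tau>) * norm (theta_dual (\<tau> / 2) \<tau>)
      * norm (theta_dual ((1 + \<tau>) / 2) \<tau>)
      = (exp (- pi * Im t / 4) * exp (pi * Im \<tau> / 4) * exp (pi * (Im \<tau> - Im t) / 4))
        * (norm (theta_prod (1 / 2) t) * norm (theta_prod (t / 2) t) * norm (theta_prod ((1 + t) / 2) t))"
    by (simp only: mult_ac)
  also have "\<dots> = 2 * exp (pi * (Im t + Im \<tau>) / 2)"
    unfolding norm_theta_prod_half_periods[OF t] by (simp add: field_simps flip: exp_add)
  finally show ?thesis
    by (simp add: t_def)
qed

lemma norm_dedekind_eta_inversion:
  assumes \<tau>: "Im \<tau> > 0"
  shows "(norm (dedekind_eta (- 1 / \<tau>)))\<^sup>2 = norm \<tau> * (norm (dedekind_eta \<tau>))\<^sup>2"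
proof -
  define t where "t = - 1 / \<tau>"
  define c where "c = qprod (exp2pi t) (exp2pi t) ^ 2 / (\<tau> * qprod (exp2pi \<tau>) (exp2pi \<tau>) ^ 2)"
  have dual: "norm (theta_dual x \<tau>) = norm c * norm (theta_prod x \<tau>)" for x
    unfolding theta_inversion[OF \<tau>] c_def t_def by (rule norm_mult)
  have "2 * exp (pi * (Im t + Im \<tau>) / 2) = norm c ^ 3 * (norm (theta_prod (1 / 2) \<tau>)
      * norm (theta_prod (\<tau> / 2) \<tau>) * norm (theta_prod ((1 + \<tau>) / 2) \<tau>))"
    using norm_theta_dual_half_periods[OF \<tau>] unfolding dual t_def by (simp add: power3_eq_cube mult_ac)
  then have "norm c ^ 3 = exp (pi * (Im t + Im \<tau>) / 2) / exp (pi * Im \<tau>)"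
    unfolding norm_theta_prod_half_periods[OF \<tau>] by (simp add: field_simps)
  also have "\<dots> = exp (pi * (Im t - Im \<tau>) / 6) ^ 3"
    by (simp add: field_simps flip: exp_diff exp_of_nat_mult)
  finally have c: "norm c = exp (pi * (Im t - Im \<tau>) / 6)"
    by (rule power_eq_imp_eq_base) auto
  have "(norm (qprod (exp2pi t) (exp2pi t)))\<^sup>2 = norm c * norm \<tau> * (norm (qprod (exp2pi \<tau>) (exp2pi \<tau>)))\<^sup>2"
    using \<tau> qprod_nonzero[of "exp2pi \<tau>" "exp2pi \<tau>"]
    by (auto simp: c_def norm_divide norm_mult norm_power)
  moreover have "exp (- (pi * Im t / 12)) ^ 2 * exp (pi * (Im t - Im \<tau>) / 6) = exp (- (pi * Im \<tau> / 12)) ^ 2"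
    by (simp add: field_simps flip: exp_add exp_of_nat_mult)
  ultimately show ?thesis
    unfolding t_def[symmetric] dedekind_eta_def norm_mult power_mult_distrib norm_exp2pi c
    by (simp add: mult_ac)
qed

subsection \<open>Growth of the Euler product\<close>

lemma Im_minus_inverse: "Im (- 1 / \<tau>) = Im \<tau> / (norm \<tau>)\<^sup>2"
  by (simp add: Im_divide cmod_power2)

lemma double_Im_le_Im_minus_inverse:
  assumes "0 < Im z" "Im z \<le> 1 / 2" "\<bar>Re z\<bar> \<le> 1 / 2"
  shows "2 * Im z \<le> Im (- 1 / z)"
proof -
  have "(norm z)\<^sup>2 \<le> (1 / 2)\<^sup>2 + (1 / 2)\<^sup>2"
    unfolding cmod_power2 using assms by (intro add_mono power2_le_iff_abs_le[THEN iffD2]) auto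
  then have "(norm z)\<^sup>2 \<le> 1 / 2"
    by (simp add: power2_eq_square)
  moreover have "z \<noteq> 0"
    using assms by auto
  ultimately show ?thesis
    using assms mult_left_mono[of "(norm z)\<^sup>2" "1 / 2" "2 * Im z"]
    unfolding Im_minus_inverse by (simp add: field_simps)
qed

lemma upper_half_plane_induct [consumes 1, case_names high translate invert]:
  assumes "Im \<tau> > 0"
    and high: "\<And>\<tau>. 1 / 2 \<le> Im \<tau> \<Longrightarrow> P \<tau>"
    and translate: "\<And>\<tau> n. P (\<tau> - of_int n) \<Longrightarrow> P \<tau>"
    and invert: "\<And>\<tau>. 0 < Im \<tau> \<Longrightarrow> P (- 1 / \<tau>) \<Longrightarrow> P \<tau>"
  shows "P \<tau>"
proof -
  have "P \<tau>" if "Im \<tau> \<ge> (1 / 2) ^ Suc n" for n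
    using that
  proof (induction n arbitrary: \<tau>)
    case 0
    then show ?case by (simp add: high)
  next
    case (Suc n)
    define z where "z = \<tau> - of_int (round (Re \<tau>))"
    have z: "Im z = Im \<tau>" "\<bar>Re z\<bar> \<le> 1 / 2"
      using of_int_round_abs_le[of "Re \<tau>"] by (auto simp: z_def abs_minus_commute)
    have pos: "Im \<tau> > 0"
      using Suc.prems by (rule less_le_trans[rotated]) simp
    show ?case
    proof (cases "1 / 2 \<le> Im \<tau>")
      case False
      then have "(1 / 2) ^ Suc n \<le> Im (- 1 / z)"
        using double_Im_le_Im_minus_inverse[of z] Suc.prems pos z by simp
      then have "P (- 1 / z)"
        by (rule Suc.IH)
      then have "P z"
        by (rule invert[rotated]) (use pos z(1) in simp)
      then show ?thesis
        unfolding z_def by (rule translate)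
    qed (rule high)
  qed
  moreover obtain n where "(1 / 2) ^ n < Im \<tau>"
    using real_arch_pow_inv[OF assms(1), of "1 / 2"] by auto
  then have "(1 / 2) ^ Suc n \<le> Im \<tau>"
    using assms(1) by simp
  ultimately show ?thesis
    by blast
qed

definition eta_height :: "complex \<Rightarrow> real" where
  "eta_height \<tau> = Im \<tau> * norm (dedekind_eta \<tau>) ^ 4"

lemma eta_height_inversion:
  assumes "Im \<tau> > 0"
  shows "eta_height (- 1 / \<tau>) = eta_height \<tau>"
proof -
  have "\<tau> \<noteq> 0"
    using assms by auto
  have "norm (dedekind_eta (- 1 / \<tau>)) ^ 4 = ((norm (dedekind_eta (- 1 / \<tau>)))\<^sup>2)\<^sup>2"
    by simp
  also have "\<dots> = (norm \<tau>)\<^sup>2 * norm (dedekind_eta \<tau>) ^ 4"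
    unfolding norm_dedekind_eta_inversion[OF assms] by (simp add: power_mult_distrib)
  finally show ?thesis
    using \<open>\<tau> \<noteq> 0\<close> unfolding eta_height_def Im_minus_inverse by simp
qed

lemma norm_dedekind_eta_power_4:
  "norm (dedekind_eta \<tau>) ^ 4 = exp (- pi * Im \<tau> / 3) * norm (qprod (exp2pi \<tau>) (exp2pi \<tau>)) ^ 4"
proof -
  have "exp (- 2 * pi * Im (\<tau> / 24)) ^ 4 = exp (- pi * Im \<tau> / 3)"
    by (simp flip: exp_of_nat_mult)
  then show ?thesis
    by (simp only: dedekind_eta_def norm_mult power_mult_distrib norm_exp2pi)
qed

lemma eta_height_minus_of_int: "eta_height (\<tau> - of_int n) = eta_height \<tau>"
  by (simp add: eta_height_def norm_dedekind_eta_power_4 exp2pi_diff)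

lemma norm_qprod_diagonal_le_small:
  assumes "norm w \<le> 1 / 2"
  shows "norm (qprod w w) \<le> exp 1"
proof -
  have "norm (qprod w w) \<le> exp (norm w / (1 - norm w))"
    using assms by (intro norm_qprod_le) simp
  also have "\<dots> \<le> exp 1"
    using assms by (simp add: field_simps)
  finally show ?thesis .
qed

lemma eta_height_le_high:
  assumes "Im \<tau> \<ge> 1 / 2"
  shows "eta_height \<tau> \<le> exp 4"
proof -
  have "norm (exp2pi \<tau>) \<le> exp (- 1)"
    unfolding norm_exp2pi using mult_mono[of 3 pi "1 / 2" "Im \<tau>"] assms pi_gt3
    by (subst exp_le_cancel_iff) auto
  also have "exp (- 1 :: real) \<le> 1 / 2"
    using exp_ge_add_one_self[of "1 :: real"] by (simp add: exp_minus field_simps)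
  finally have "norm (qprod (exp2pi \<tau>) (exp2pi \<tau>)) ^ 4 \<le> exp 1 ^ 4"
    by (intro power_mono norm_qprod_diagonal_le_small) auto
  moreover have "Im \<tau> * exp (- pi * Im \<tau> / 3) \<le> 1"
  proof -
    have "Im \<tau> \<le> exp (Im \<tau>)"
      using exp_ge_add_one_self[of "Im \<tau>"] by linarith
    also have "\<dots> \<le> exp (pi * Im \<tau> / 3)"
      using mult_right_mono[of 3 pi "Im \<tau>"] assms pi_gt3 by auto
    finally show ?thesis
      by (simp add: exp_minus field_simps)
  qed
  ultimately have "Im \<tau> * exp (- pi * Im \<tau> / 3) * norm (qprod (exp2pi \<tau>) (exp2pi \<tau>)) ^ 4 \<le> 1 * exp 1 ^ 4"
    by (intro mult_mono) auto
  then show ?thesis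
    by (simp add: eta_height_def norm_dedekind_eta_power_4 flip: exp_of_nat_mult)
qed

lemma eta_height_le:
  assumes "Im \<tau> > 0"
  shows "eta_height \<tau> \<le> exp 4"
  using assms
proof (induction \<tau> rule: upper_half_plane_induct)
  case (high \<tau>)
  then show ?case by (rule eta_height_le_high)
next
  case (translate \<tau> n)
  then show ?case by (simp only: eta_height_minus_of_int)
next
  case (invert \<tau>)
  then show ?case by (simp only: eta_height_inversion)
qed

lemma norm_qprod_diagonal_power_4_mult_le:
  assumes w: "norm w = exp (- t)" and t: "0 < t" "t \<le> 1"
  shows "norm (qprod w w) ^ 4 * t \<le> 8 * exp 5"
proof -
  define \<tau> where "\<tau> = Ln w / (2 * of_real pi * \<i>)"
  have "w \<noteq> 0"
    using w by auto
  then have "exp2pi \<tau> = w"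
    by (simp add: exp2pi_def \<tau>_def)
  moreover have Im_\<tau>: "Im \<tau> = t / (2 * pi)"
    using \<open>w \<noteq> 0\<close> by (simp add: \<tau>_def w Im_divide power2_eq_square)
  moreover have "eta_height \<tau> \<le> exp 4"
    using t(1) by (intro eta_height_le) (simp add: Im_\<tau>)
  ultimately have "t / (2 * pi) * (exp (- t / 6) * norm (qprod w w) ^ 4) \<le> exp 4"
    by (simp add: eta_height_def norm_dedekind_eta_power_4)
  then have "norm (qprod w w) ^ 4 * t \<le> 2 * pi * (exp 4 * exp (t / 6))"
    by (simp add: exp_minus field_simps)
  also have "\<dots> \<le> 8 * exp 5"
    unfolding exp_add[symmetric] using t(2) pi_less_4 by (intro mult_mono) auto
  finally show ?thesis .
qed

lemma norm_qprod_diagonal_power_4_le: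
  assumes "norm w < 1"
  shows "norm (qprod w w) ^ 4 * (1 - norm w) \<le> 8 * exp 5"
proof (cases "norm w \<le> 1 / 2")
  case True
  then have "norm (qprod w w) ^ 4 * (1 - norm w) \<le> exp 1 ^ 4 * 1"
    by (intro mult_mono power_mono norm_qprod_diagonal_le_small) auto
  also have "\<dots> = exp (4 :: real)"
    by (simp flip: exp_of_nat_mult)
  also have "exp 4 \<le> 8 * exp (5 :: real)"
    by (rule order.trans[of _ "1 * exp 5"]) auto
  finally show ?thesis .
next
  case False
  define t where "t = - ln (norm w)"
  have "0 < norm w"
    using False by linarith
  then have w: "norm w = exp (- t)"
    by (simp add: t_def)
  have "1 / norm w \<le> 2"
    using False \<open>0 < norm w\<close> by (simp add: divide_le_eq)
  then have "t \<le> 1"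
    using ln_le_minus_one[of "1 / norm w"] \<open>0 < norm w\<close> by (simp add: t_def ln_div)
  have "norm (qprod w w) ^ 4 * (1 - norm w) \<le> norm (qprod w w) ^ 4 * t"
    using ln_le_minus_one[of "norm w"] \<open>0 < norm w\<close> by (intro mult_left_mono) (auto simp: t_def)
  also have "\<dots> \<le> 8 * exp 5"
    using w \<open>t \<le> 1\<close> assms by (intro norm_qprod_diagonal_power_4_mult_le) auto
  finally show ?thesis .
qed

lemma norm_qprod_diagonal_le:
  assumes "norm w < 1"
  shows "norm (qprod w w) \<le> (8 * exp 5) powr (1 / 4) * (1 - norm w) powr (- (1 / 4))"
proof -
  have "norm (qprod w w) = (norm (qprod w w) ^ 4) powr (1 / 4)"
    by (cases "qprod w w = 0") (simp_all add: powr_powr flip: powr_numeral)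
  also have "\<dots> \<le> (8 * exp 5 / (1 - norm w)) powr (1 / 4)"
    using norm_qprod_diagonal_power_4_le[OF assms] assms by (intro powr_mono2) (auto simp: field_simps)
  also have "\<dots> = (8 * exp 5) powr (1 / 4) * (1 - norm w) powr (- (1 / 4))"
    using assms by (simp add: powr_divide powr_minus field_simps)
  finally show ?thesis .
qed

subsection \<open>The coefficients of the Euler product\<close>

lemma fps_nth_prod_one_minus_X_power_in_Ints:
  "fps_nth (\<Prod>k<N. 1 - fps_X * fps_X ^ k :: complex fps) n \<in> \<int>"
proof (induction N arbitrary: n)
  case (Suc N)
  have "fps_nth (1 - fps_X * fps_X ^ N :: complex fps) i \<in> \<int>" for i
    by (simp flip: power_Suc)
  then show ?case
    unfolding prod.lessThan_Suc fps_mult_nth by (intro Ints_sum Ints_mult Suc)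
qed auto

lemma higher_deriv_qprod_diagonal_in_Ints:
  "(deriv ^^ n) (\<lambda>w. qprod w w) 0 / fact n \<in> \<int>"
proof -
  have "uniform_limit (cball 0 (1/2)) (\<lambda>n x. \<Prod>k<n. 1 - x * x ^ k) (\<lambda>x. qprod x x) sequentially"
    by (rule uniform_limit_qprod) (auto intro!: continuous_intros)
  then have "uniform_limit (ball 0 (1/2)) (\<lambda>n x. \<Prod>k<n. 1 - x * x ^ k) (\<lambda>x. qprod x x) sequentially"
    by (rule uniform_limit_on_subset) auto
  then have "(\<lambda>N. (deriv ^^ n) (\<lambda>x. \<Prod>k<N. 1 - x * x ^ k) 0) \<longlonglongrightarrow> (deriv ^^ n) (\<lambda>x. qprod x x) 0"
    by (rule higher_deriv_complex_uniform_limit) (auto intro!: always_eventually holomorphic_intros)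
  then have lim: "(\<lambda>N. (deriv ^^ n) (\<lambda>x. \<Prod>k<N. 1 - x * x ^ k) 0 / fact n)
      \<longlonglongrightarrow> (deriv ^^ n) (\<lambda>x. qprod x x) 0 / fact n"
    by (intro tendsto_intros) auto
  have mem: "(deriv ^^ n) (\<lambda>x. \<Prod>k<N. 1 - x * x ^ k) 0 / fact n \<in> (\<int> :: complex set)" for N
  proof -
    have "(\<lambda>x::complex. \<Prod>k<N. 1 - x * x ^ k) has_fps_expansion (\<Prod>k<N. 1 - fps_X * fps_X ^ k)"
      by (intro fps_expansion_intros)
    from fps_nth_fps_expansion[OF this, of n] show ?thesis
      using fps_nth_prod_one_minus_X_power_in_Ints[of N n] by (simp only:)
  qed
  show ?thesis
    by (rule closed_sequentially[OF closed_Ints mem lim])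
qed

lemma power_series_coeff_unique:
  fixes a b :: "nat \<Rightarrow> complex"
  assumes "\<And>z. norm z < 1 \<Longrightarrow> (\<lambda>n. a n * z ^ n) sums f z" "\<And>z. norm z < 1 \<Longrightarrow> (\<lambda>n. b n * z ^ n) sums f z"
  shows "a = b"
proof -
  have expansion: "f has_fps_expansion Abs_fps c" if c: "\<And>z. norm z < 1 \<Longrightarrow> (\<lambda>n. c n * z ^ n) sums f z" for c
  proof (rule has_fps_expansionI)
    have "eventually (\<lambda>z. z \<in> ball 0 1) (nhds (0::complex))"
      by (intro eventually_nhds_in_open) auto
    then show "\<forall>\<^sub>F z in nhds 0. (\<lambda>n. fps_nth (Abs_fps c) n * z ^ n) sums f z"
      by eventually_elim (simp add: c)
  qed
  have "Abs_fps a = Abs_fps b"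
    using expansion[of a] expansion[of b] assms by (intro fps_expansion_unique_complex) blast+
  then show ?thesis
    by (simp add: fun_eq_iff fps_eq_iff)
qed

lemma qprod_diagonal_integer_power_series:
  obtains a :: "nat \<Rightarrow> int" where "\<And>w. norm w < 1 \<Longrightarrow> (\<lambda>n. of_int (a n) * w ^ n) sums qprod w w"
proof -
  have "\<forall>n. \<exists>k::int. (deriv ^^ n) (\<lambda>w. qprod w w) 0 / fact n = of_int k"
    using higher_deriv_qprod_diagonal_in_Ints Ints_cases by blast
  then obtain a :: "nat \<Rightarrow> int" where "\<And>n. (deriv ^^ n) (\<lambda>w. qprod w w) 0 / fact n = of_int (a n)"
    by metis
  moreover have "(\<lambda>w. qprod w w) holomorphic_on ball 0 1"
    by (rule holomorphic_on_qprod) auto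
  ultimately show thesis
    using that[of a] holomorphic_power_series[of "\<lambda>w. qprod w w" 0 1] by simp
qed

lemma euler_coeff_sums:
  assumes "norm w < 1"
  shows "(\<lambda>n. of_int (euler_coeff n) * w ^ n) sums qprod w w"
proof -
  define is_coeff :: "(nat \<Rightarrow> int) \<Rightarrow> bool"
    where "is_coeff a \<longleftrightarrow> (\<forall>w::complex. norm w < 1 \<longrightarrow> (\<lambda>n. of_int (a n) * w ^ n) sums qprod w w)" for a
  obtain a where a: "is_coeff a"
    using qprod_diagonal_integer_power_series unfolding is_coeff_def by metis
  have "b = a" if "is_coeff b" for b
  proof -
    have "(\<lambda>n. of_int (b n) :: complex) = (\<lambda>n. of_int (a n))"
      using a that by (intro power_series_coeff_unique[of _ "\<lambda>w. qprod w w"]) (auto simp: is_coeff_def)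
    then show ?thesis
      by (simp add: fun_eq_iff)
  qed
  with a have "is_coeff (THE a. is_coeff a)"
    by (rule theI)
  also have "(THE a. is_coeff a) = euler_coeff"
    by (simp add: euler_coeff_def is_coeff_def qprod_def)
  finally show ?thesis
    using assms by (simp add: is_coeff_def)
qed

subsection \<open>Fractional integration of power series\<close>

lemma summable_norm_power_series_unit_disc:
  fixes b :: "nat \<Rightarrow> complex"
  assumes "\<And>z. norm z < 1 \<Longrightarrow> summable (\<lambda>n. b n * z ^ n)" "norm z < 1"
  shows "summable (\<lambda>n. norm (b n * z ^ n))"
proof -
  obtain r where "norm z < r" "r < 1"
    using dense[OF assms(2)] by blast
  then have r: "norm z < norm (of_real r :: complex)" "norm (of_real r :: complex) < 1"
    using norm_ge_zero[of z] by (auto simp del: norm_ge_zero)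
  from powser_insidea[OF assms(1)[OF r(2)] r(1)] show ?thesis .
qed

definition frac_integral :: "real \<Rightarrow> (nat \<Rightarrow> complex) \<Rightarrow> nat \<Rightarrow> complex" where
  "frac_integral s c n = c n / of_real (real n powr s)"

lemma frac_integral_0 [simp]: "frac_integral s c 0 = 0"
  by (simp add: frac_integral_def)

lemma norm_frac_integral_le:
  assumes "0 \<le> s"
  shows "norm (frac_integral s c n) \<le> norm (c n)"
proof (cases "n = 0")
  case False
  then have "1 \<le> real n powr s"
    using assms by (intro ge_one_powr_ge_zero) auto
  then show ?thesis
    using mult_left_mono[of 1 "real n powr s" "norm (c n)"]
    by (simp add: frac_integral_def norm_divide divide_le_eq)
qed auto

lemma summable_norm_frac_integral:
  assumes "0 \<le> s" "summable (\<lambda>n. norm (c n * z ^ n))"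
  shows "summable (\<lambda>n. norm (frac_integral s c n * z ^ n))"
  using assms(2)
  by (rule summable_comparison_test'[where N = 0])
    (auto simp: norm_mult intro!: mult_right_mono norm_frac_integral_le assms(1))

lemma Gamma_integral_scaled:
  fixes s c :: real
  assumes "0 < s" "0 < c"
  shows "((\<lambda>y. y powr (s - 1) * exp (- c * y)) has_integral Gamma s / c powr s) {0..}"
proof -
  define f where "f t = t powr (s - 1) / exp t" for t :: real
  have f: "(f has_integral Gamma s) {0..}"
    unfolding f_def by (rule Gamma_integral_real[OF assms(1)])
  then have "f absolutely_integrable_on {0..}"
    by (intro nonnegative_absolutely_integrable_1) (auto simp: f_def has_integral_integrable)
  moreover have "(\<lambda>y. c * y) ` {0..} = {0..}"
    using assms(2) by (auto intro: image_eqI[of _ _ "x / c" for x])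
  ultimately have "(\<lambda>y. \<bar>c\<bar> * f (c * y)) absolutely_integrable_on {0..}
      \<and> integral {0..} (\<lambda>y. \<bar>c\<bar> * f (c * y)) = Gamma s"
    using f assms(2)
    by (subst has_absolute_integral_change_of_variables_1')
      (auto intro!: derivative_eq_intros simp: inj_on_def integral_unique)
  then have "((\<lambda>y. c * f (c * y)) has_integral Gamma s) {0..}"
    using assms(2) by (auto simp: has_integral_iff set_lebesgue_integral_eq_integral(1))
  then have "((\<lambda>y. c * f (c * y) / c powr s) has_integral Gamma s / c powr s) {0..}"
    by (rule has_integral_divide)
  moreover have "c * f (c * y) / c powr s = y powr (s - 1) * exp (- c * y)" if "y \<in> {0..}" for y
    using assms that by (simp add: f_def powr_mult powr_diff exp_minus field_simps)
  ultimately show ?thesis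
    by (rule has_integral_eq[rotated])
qed

lemma frac_integral_coeff_has_integral:
  assumes "0 < s" "n > 0"
  shows "((\<lambda>y. y powr (s - 1) *\<^sub>R (c n * (of_real (exp (- y)) * z) ^ n))
    has_integral Gamma s *\<^sub>R (frac_integral s c n * z ^ n)) {0..}"
proof -
  have "((\<lambda>y. (y powr (s - 1) * exp (- real n * y)) *\<^sub>R (c n * z ^ n))
      has_integral (Gamma s / real n powr s) *\<^sub>R (c n * z ^ n)) {0..}"
    using assms by (intro has_integral_scaleR_left Gamma_integral_scaled) auto
  moreover have "exp (- real n * y) = exp (- y) ^ n" for y
    using exp_of_nat_mult[of n "- y"] by simp
  ultimately show ?thesis
    by (simp add: frac_integral_def scaleR_conv_of_real power_mult_distrib mult_ac)
qed

lemma norm_damped_term_le: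
  fixes c :: "nat \<Rightarrow> complex"
  assumes "c 0 = 0" "0 \<le> y"
  shows "norm (c n * (of_real (exp (- y)) * z) ^ n) \<le> exp (- y) * norm (c n * z ^ n)"
proof (cases "n = 0")
  case False
  then have "exp (- y) ^ n \<le> exp (- y)"
    using assms(2) power_decreasing[of 1 n "exp (- y)"] by simp
  then show ?thesis
    by (simp add: norm_mult norm_power power_mult_distrib mult.left_commute mult_left_mono mult_right_mono)
qed (use assms(1) in auto)

lemma summable_norm_damped:
  fixes c :: "nat \<Rightarrow> complex"
  assumes "c 0 = 0" "0 \<le> y" "summable (\<lambda>n. norm (c n * z ^ n))"
  shows "summable (\<lambda>n. norm (c n * (of_real (exp (- y)) * z) ^ n))"
  by (rule summable_comparison_test'[OF summable_mult[OF assms(3)]])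
    (use norm_damped_term_le[where c = c, OF assms(1,2)] in auto)

lemma frac_integral_has_integral:
  assumes s: "0 < s" and c0: "c 0 = 0" and summable: "summable (\<lambda>n. norm (c n * z ^ n))"
  shows "((\<lambda>y. y powr (s - 1) *\<^sub>R (\<Sum>n. c n * (of_real (exp (- y)) * z) ^ n))
    has_integral Gamma s *\<^sub>R (\<Sum>n. frac_integral s c n * z ^ n)) {0..}"
proof (rule has_integral_dominated_convergence)
  let ?M = "\<Sum>n. norm (c n * z ^ n)"
  show "((\<lambda>y. y powr (s - 1) *\<^sub>R (\<Sum>n<N. c n * (of_real (exp (- y)) * z) ^ n))
      has_integral Gamma s *\<^sub>R (\<Sum>n<N. frac_integral s c n * z ^ n)) {0..}" for N
    unfolding scaleR_sum_right
  proof (intro has_integral_sum)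
    show "((\<lambda>y. y powr (s - 1) *\<^sub>R (c n * (of_real (exp (- y)) * z) ^ n))
        has_integral Gamma s *\<^sub>R (frac_integral s c n * z ^ n)) {0..}" for n
      using frac_integral_coeff_has_integral[OF s, of n c z] c0 by (cases "n = 0") auto
  qed auto
  show "(\<lambda>y. y powr (s - 1) * exp (- 1 * y) * ?M) integrable_on {0..}"
    by (intro integrable_on_mult_left has_integral_integrable[OF Gamma_integral_scaled] s) auto
  show "\<forall>y\<in>{0..}. norm (y powr (s - 1) *\<^sub>R (\<Sum>n<N. c n * (of_real (exp (- y)) * z) ^ n))
      \<le> y powr (s - 1) * exp (- 1 * y) * ?M" for N
  proof
    fix y :: real assume "y \<in> {0..}"
    then have "norm (\<Sum>n<N. c n * (of_real (exp (- y)) * z) ^ n) \<le> (\<Sum>n<N. exp (- y) * norm (c n * z ^ n))"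
      by (intro sum_norm_le norm_damped_term_le c0) auto
    also have "\<dots> \<le> exp (- y) * ?M"
      unfolding sum_distrib_left[symmetric] by (intro mult_left_mono sum_le_suminf summable) auto
    finally show "norm (y powr (s - 1) *\<^sub>R (\<Sum>n<N. c n * (of_real (exp (- y)) * z) ^ n))
        \<le> y powr (s - 1) * exp (- 1 * y) * ?M"
      by (simp add: mult_left_mono mult.assoc)
  qed
  show "\<forall>y\<in>{0..}. (\<lambda>N. y powr (s - 1) *\<^sub>R (\<Sum>n<N. c n * (of_real (exp (- y)) * z) ^ n))
      \<longlonglongrightarrow> y powr (s - 1) *\<^sub>R (\<Sum>n. c n * (of_real (exp (- y)) * z) ^ n)"
    by (intro ballI tendsto_intros summable_LIMSEQ c0 summable summable_norm_cancel[OF summable_norm_damped])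
      auto
  show "(\<lambda>N. Gamma s *\<^sub>R (\<Sum>n<N. frac_integral s c n * z ^ n))
      \<longlonglongrightarrow> Gamma s *\<^sub>R (\<Sum>n. frac_integral s c n * z ^ n)"
    using s summable
    by (intro tendsto_intros summable_LIMSEQ summable_norm_cancel[OF summable_norm_frac_integral]) auto
qed

lemma norm_Mellin_integral_le:
  fixes f :: "real \<Rightarrow> 'a::banach"
  assumes integral: "((\<lambda>y. y powr (s - 1) *\<^sub>R f y) has_integral I) {0..}" and s: "0 < s" "\<kappa> < s"
    and f: "\<And>y. 0 < y \<Longrightarrow> norm (f y) \<le> A * (y powr (- \<kappa>) * exp (- y)) + B * exp (- y)"
  shows "norm I \<le> A * Gamma (s - \<kappa>) + B * Gamma s"
proof -
  let ?h = "\<lambda>y. A * (y powr (s - \<kappa> - 1) * exp (- 1 * y)) + B * (y powr (s - 1) * exp (- 1 * y))"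
  have h: "(?h has_integral A * (Gamma (s - \<kappa>) / 1 powr (s - \<kappa>)) + B * (Gamma s / 1 powr s)) {0..}"
    using s by (intro has_integral_add has_integral_mult_right Gamma_integral_scaled) auto
  have "norm (integral {0..} (\<lambda>y. y powr (s - 1) *\<^sub>R f y)) \<le> integral {0..} ?h"
  proof (rule integral_norm_bound_integral)
    show "norm (y powr (s - 1) *\<^sub>R f y) \<le> ?h y" if "y \<in> {0..}" for y
    proof (cases "y = 0")
      case False
      with that have "norm (y powr (s - 1) *\<^sub>R f y)
          \<le> y powr (s - 1) * (A * (y powr (- \<kappa>) * exp (- y)) + B * exp (- y))"
        using f by (simp add: mult_left_mono)
      also have "\<dots> = A * (y powr (s - 1 + - \<kappa>) * exp (- y)) + B * (y powr (s - 1) * exp (- y))"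
        unfolding powr_add by (simp add: algebra_simps)
      finally show ?thesis
        by (simp add: algebra_simps)
    qed auto
  qed (use integral h in \<open>auto simp: has_integral_integrable\<close>)
  then show ?thesis
    unfolding integral_unique[OF integral] integral_unique[OF h] by simp
qed

lemma power_series_exp_decay:
  fixes c :: "nat \<Rightarrow> complex"
  assumes c0: "c 0 = 0" and summable: "\<And>z. norm z < 1 \<Longrightarrow> summable (\<lambda>n. c n * z ^ n)"
  obtains A where "0 \<le> A"
    "\<And>y z. 1 \<le> y \<Longrightarrow> norm z < 1 \<Longrightarrow> norm (\<Sum>n. c n * (of_real (exp (- y)) * z) ^ n) \<le> A * exp (- y)"
proof
  define \<rho> :: complex where "\<rho> = of_real (exp (- 1))"
  have norm_\<rho>: "norm \<rho> = exp (- 1)"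
    by (simp add: \<rho>_def)
  have \<rho>: "summable (\<lambda>n. norm (c n * \<rho> ^ n))"
    by (rule summable_norm_power_series_unit_disc[OF summable]) (simp_all add: norm_\<rho>)
  show "0 \<le> exp 1 * (\<Sum>n. norm (c n * \<rho> ^ n))"
    by (intro mult_nonneg_nonneg suminf_nonneg \<rho>) auto
  fix y :: real and z :: complex assume y: "1 \<le> y" and z: "norm z < 1"
  have "exp (- y) = exp (- (y - 1)) * exp (- 1)"
    by (simp flip: exp_add)
  then have factor: "of_real (exp (- y)) * z = of_real (exp (- (y - 1))) * (\<rho> * z)"
    by (simp only: \<rho>_def of_real_mult mult.assoc)
  have "norm (c n * (of_real (exp (- y)) * z) ^ n) \<le> exp (- (y - 1)) * norm (c n * \<rho> ^ n)" for n
  proof -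
    have "norm (c n * (of_real (exp (- y)) * z) ^ n) \<le> exp (- (y - 1)) * norm (c n * (\<rho> * z) ^ n)"
      unfolding factor using y by (intro norm_damped_term_le c0) simp
    also have "norm (c n * (\<rho> * z) ^ n) \<le> norm (c n * \<rho> ^ n)"
      using z by (simp add: norm_mult norm_power power_mult_distrib mult_left_le mult_left_mono power_le_one)
    finally show ?thesis
      by simp
  qed
  then have "norm (\<Sum>n. c n * (of_real (exp (- y)) * z) ^ n) \<le> (\<Sum>n. exp (- (y - 1)) * norm (c n * \<rho> ^ n))"
    by (intro norm_suminf_le summable_mult \<rho>)
  also have "\<dots> = exp 1 * (\<Sum>n. norm (c n * \<rho> ^ n)) * exp (- y)"
    by (subst suminf_mult[OF \<rho>]) (simp add: exp_diff exp_minus field_simps)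
  finally show "norm (\<Sum>n. c n * (of_real (exp (- y)) * z) ^ n)
      \<le> exp 1 * (\<Sum>n. norm (c n * \<rho> ^ n)) * exp (- y)" .
qed

lemma half_le_one_minus_exp_minus:
  fixes y :: real
  assumes "0 \<le> y" "y \<le> 1"
  shows "y / 2 \<le> 1 - exp (- y)"
proof -
  have "exp (- y) \<le> 1 / (1 + y)"
    using exp_ge_add_one_self[of y] assms by (simp add: exp_minus field_simps)
  also have "\<dots> \<le> 1 - y / 2"
    using assms mult_left_le[of y y] by (simp add: field_simps)
  finally show ?thesis
    by simp
qed

lemma power_series_damped_growth:
  fixes c :: "nat \<Rightarrow> complex"
  assumes \<kappa>: "0 \<le> \<kappa>"
    and growth: "\<And>z. norm z < 1 \<Longrightarrow> norm (\<Sum>n. c n * z ^ n) \<le> K * (1 - norm z) powr (- \<kappa>)"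
    and y: "0 < y" "y \<le> 1" and z: "norm z < 1"
  shows "norm (\<Sum>n. c n * (of_real (exp (- y)) * z) ^ n) \<le> K * 2 powr \<kappa> * exp 1 * (y powr (- \<kappa>) * exp (- y))"
proof -
  have K: "0 \<le> K"
    using order.trans[OF norm_ge_zero growth[of 0]] by simp
  define w where "w = of_real (exp (- y)) * z"
  have "norm w \<le> exp (- y)"
    unfolding w_def norm_mult using z mult_left_mono[of "norm z" 1 "exp (- y)"] by simp
  then have w: "y / 2 \<le> 1 - norm w"
    using half_le_one_minus_exp_minus[of y] y by simp
  then have "norm (\<Sum>n. c n * w ^ n) \<le> K * (1 - norm w) powr (- \<kappa>)"
    using y by (intro growth) simp
  also have "(1 - norm w) powr (- \<kappa>) \<le> (y / 2) powr (- \<kappa>)"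
    using w y \<kappa> by (intro powr_mono2') auto
  also have "(y / 2) powr (- \<kappa>) = 2 powr \<kappa> * (y powr (- \<kappa>) * 1)"
    using y by (simp add: powr_divide powr_minus field_simps)
  also have "K * \<dots> \<le> K * (2 powr \<kappa> * (y powr (- \<kappa>) * exp (1 - y)))"
    using K y by (intro mult_left_mono) auto
  also have "\<dots> = K * 2 powr \<kappa> * exp 1 * (y powr (- \<kappa>) * exp (- y))"
    by (simp add: exp_diff exp_minus field_simps)
  finally show ?thesis
    using K by (simp add: w_def mult_left_mono)
qed

lemma frac_integral_bounded_of_coeff_0:
  fixes c :: "nat \<Rightarrow> complex"
  assumes c0: "c 0 = 0" and \<kappa>: "0 \<le> \<kappa>" "\<kappa> < s"
    and summable: "\<And>z. norm z < 1 \<Longrightarrow> summable (\<lambda>n. c n * z ^ n)"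
    and growth: "\<And>z. norm z < 1 \<Longrightarrow> norm (\<Sum>n. c n * z ^ n) \<le> K * (1 - norm z) powr (- \<kappa>)"
  obtains C where "\<And>z. norm z < 1 \<Longrightarrow> norm (\<Sum>n. frac_integral s c n * z ^ n) \<le> C"
proof -
  let ?f = "\<lambda>z y. \<Sum>n. c n * (of_real (exp (- y)) * z) ^ n"
  have s: "0 < s"
    using \<kappa> by simp
  obtain B where B: "0 \<le> B" "\<And>y z. 1 \<le> y \<Longrightarrow> norm z < 1 \<Longrightarrow> norm (?f z y) \<le> B * exp (- y)"
    using power_series_exp_decay[OF c0 summable] by blast
  define A where "A = K * 2 powr \<kappa> * exp 1"
  have A: "0 \<le> A"
    using order.trans[OF norm_ge_zero growth[of 0]] by (simp add: A_def)
  have "norm (\<Sum>n. frac_integral s c n * z ^ n) \<le> (A * Gamma (s - \<kappa>) + B * Gamma s) / Gamma s"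
    if z: "norm z < 1" for z
  proof -
    have "norm (?f z y) \<le> A * (y powr (- \<kappa>) * exp (- y)) + B * exp (- y)" if "0 < y" for y
      using B(2)[of y z] power_series_damped_growth[OF \<kappa>(1) growth, of y z] z that A B(1)
      by (cases "y \<le> 1") (auto simp: A_def intro: add_increasing add_increasing2)
    moreover have "((\<lambda>y. y powr (s - 1) *\<^sub>R ?f z y)
        has_integral Gamma s *\<^sub>R (\<Sum>n. frac_integral s c n * z ^ n)) {0..}"
      by (intro frac_integral_has_integral[OF s] c0 summable_norm_power_series_unit_disc summable z)
    ultimately have "norm (Gamma s *\<^sub>R (\<Sum>n. frac_integral s c n * z ^ n)) \<le> A * Gamma (s - \<kappa>) + B * Gamma s"
      using s \<kappa>(2) by (intro norm_Mellin_integral_le) auto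
    then show ?thesis
      using Gamma_real_pos[OF s] by (simp add: field_simps)
  qed
  then show thesis
    by (rule that)
qed

lemma frac_integral_bounded:
  fixes c :: "nat \<Rightarrow> complex"
  assumes \<kappa>: "0 \<le> \<kappa>" "\<kappa> < s" and summable: "\<And>z. norm z < 1 \<Longrightarrow> summable (\<lambda>n. c n * z ^ n)"
    and growth: "\<And>z. norm z < 1 \<Longrightarrow> norm (\<Sum>n. c n * z ^ n) \<le> K * (1 - norm z) powr (- \<kappa>)"
  obtains C where "\<And>z. norm z < 1 \<Longrightarrow> norm (\<Sum>n. frac_integral s c n * z ^ n) \<le> C"
proof -
  have sums: "(\<lambda>n. (c(0 := 0)) n * z ^ n) sums ((\<Sum>n. c n * z ^ n) - c 0)" if "norm z < 1" for z
  proof -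
    have "(c(0 := 0)) n * z ^ n = c n * z ^ n - (if n = 0 then c 0 else 0)" for n
      by simp
    then show ?thesis
      using sums_diff[OF summable_sums[OF summable[OF that]] sums_single[of 0 "\<lambda>_. c 0"]] by (simp only:)
  qed
  have "norm (\<Sum>n. (c(0 := 0)) n * z ^ n) \<le> (K + norm (c 0)) * (1 - norm z) powr (- \<kappa>)"
    if z: "norm z < 1" for z
  proof -
    have "1 powr (- \<kappa>) \<le> (1 - norm z) powr (- \<kappa>)"
      using z \<kappa>(1) by (intro powr_mono2') auto
    then have "norm (c 0) \<le> norm (c 0) * (1 - norm z) powr (- \<kappa>)"
      using mult_left_mono[of 1 _ "norm (c 0)"] by simp
    with growth[OF z] have "norm ((\<Sum>n. c n * z ^ n) - c 0) \<le> (K + norm (c 0)) * (1 - norm z) powr (- \<kappa>)"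
      using norm_triangle_ineq4[of "\<Sum>n. c n * z ^ n" "c 0"] by (simp add: ring_distribs)
    then show ?thesis
      by (simp only: sums_unique[OF sums[OF z], symmetric])
  qed
  moreover have "frac_integral s (c(0 := 0)) = frac_integral s c"
    by (auto simp: frac_integral_def)
  ultimately show ?thesis
    using that sums_summable[OF sums] frac_integral_bounded_of_coeff_0[of "c(0 := 0)" \<kappa> s "K + norm (c 0)"] \<kappa>
    by auto
qed

subsection \<open>Cauchy products with a bounded power series\<close>

lemma sum_roots_unity_orthogonal:
  assumes "m < N" "n < N"
  shows "(\<Sum>w | w ^ N = 1. w ^ m * cnj (w ^ n)) = (if m = n then of_nat N else 0 :: complex)"
proof -
  define x where "x = cis (2 * pi * (real m - real n) / real N)"
  have roots: "bij_betw (\<lambda>k. cis (2 * pi * real k / real N)) {..<N} {w. w ^ N = 1}"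
    using assms by (intro Complex.bij_betw_roots_unity) auto
  have term_eq: "cis (2 * pi * real k / real N) ^ m * cnj (cis (2 * pi * real k / real N) ^ n) = x ^ k" for k
    by (simp add: x_def Complex.DeMoivre cis_mult cis_cnj algebra_simps diff_divide_distrib)
  have "(\<Sum>w | w ^ N = 1. w ^ m * cnj (w ^ n)) = (\<Sum>k<N. x ^ k)"
    using sum.reindex_bij_betw[OF roots, of "\<lambda>w. w ^ m * cnj (w ^ n)"] by (simp only: term_eq)
  also have "\<dots> = (if m = n then of_nat N else 0)"
  proof (cases "m = n")
    case False
    have "x \<noteq> 1"
    proof
      assume "x = 1"
      then have "cis (2 * pi * real m / real N) = cis (2 * pi * real n / real N)"
        by (simp add: x_def ring_distribs diff_divide_distrib flip: cis_divide)
      with roots assms False show False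
        by (auto simp: bij_betw_def inj_on_def)
    qed
    moreover have "x ^ N = 1"
      using assms by (simp add: x_def Complex.DeMoivre)
    ultimately show ?thesis
      using False by (simp add: sum_gp_strict)
  qed (simp add: x_def)
  finally show ?thesis .
qed

lemma Parseval_poly_roots_unity:
  fixes p :: "complex poly"
  assumes "degree p < N"
  shows "(\<Sum>w | w ^ N = 1. (norm (poly p w))\<^sup>2) = real N * (\<Sum>n<N. (norm (coeff p n))\<^sup>2)"
proof -
  let ?c = "coeff p"
  have poly: "poly p w = (\<Sum>n<N. ?c n * w ^ n)" for w
    unfolding poly_altdef using assms by (intro sum.mono_neutral_left) (auto simp: coeff_eq_0)
  have "complex_of_real (\<Sum>w | w ^ N = 1. (norm (poly p w))\<^sup>2)
      = (\<Sum>w | w ^ N = 1. \<Sum>m<N. \<Sum>n<N. ?c m * cnj (?c n) * (w ^ m * cnj (w ^ n)))"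
    by (simp only: of_real_sum complex_norm_square poly cnj_sum sum_product complex_cnj_mult mult_ac)
  also have "\<dots> = (\<Sum>m<N. \<Sum>w | w ^ N = 1. \<Sum>n<N. ?c m * cnj (?c n) * (w ^ m * cnj (w ^ n)))"
    by (rule sum.swap)
  also have "\<dots> = (\<Sum>m<N. \<Sum>n<N. \<Sum>w | w ^ N = 1. ?c m * cnj (?c n) * (w ^ m * cnj (w ^ n)))"
    by (intro sum.cong refl sum.swap)
  also have "\<dots> = (\<Sum>m<N. \<Sum>n<N. ?c m * cnj (?c n) * (if m = n then of_nat N else 0))"
    unfolding sum_distrib_left[symmetric]
    by (intro sum.cong refl) (simp only: lessThan_iff sum_roots_unity_orthogonal)
  also have "\<dots> = complex_of_real (real N * (\<Sum>n<N. (norm (?c n))\<^sup>2))"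
    unfolding of_real_mult of_real_sum complex_norm_square
    by (simp add: if_distrib sum_distrib_left mult_ac cong: if_cong)
  finally show ?thesis
    by (simp only: of_real_eq_iff)
qed

lemma sum_norm_coeff_mult_le:
  fixes p r :: "complex poly"
  assumes p: "\<And>w. norm w = 1 \<Longrightarrow> norm (poly p w) \<le> S" and r: "degree r < L"
  shows "(\<Sum>n<K. (norm (coeff (p * r) n))\<^sup>2) \<le> S\<^sup>2 * (\<Sum>n<L. (norm (coeff r n))\<^sup>2)"
proof -
  define N where "N = K + degree p + L"
  have N: "N > 0" "degree r < N" "degree (p * r) < N"
    using r degree_mult_le[of p r] by (auto simp: N_def)
  have unit: "norm w = 1" if "w ^ N = 1" for w :: complex
    using power_eq_1_iff[OF that] N(1) by simp
  have "real N * (\<Sum>n<N. (norm (coeff (p * r) n))\<^sup>2)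
      = (\<Sum>w | w ^ N = 1. (norm (poly p w))\<^sup>2 * (norm (poly r w))\<^sup>2)"
    using Parseval_poly_roots_unity[OF N(3)] by (simp add: norm_mult power_mult_distrib)
  also have "\<dots> \<le> (\<Sum>w | w ^ N = 1. S\<^sup>2 * (norm (poly r w))\<^sup>2)"
    using unit by (intro sum_mono mult_right_mono power_mono p) auto
  also have "\<dots> = real N * (S\<^sup>2 * (\<Sum>n<N. (norm (coeff r n))\<^sup>2))"
    using Parseval_poly_roots_unity[OF N(2)] by (simp flip: sum_distrib_left)
  finally have "(\<Sum>n<N. (norm (coeff (p * r) n))\<^sup>2) \<le> S\<^sup>2 * (\<Sum>n<N. (norm (coeff r n))\<^sup>2)"
    using N(1) by simp
  moreover have "(\<Sum>n<K. (norm (coeff (p * r) n))\<^sup>2) \<le> (\<Sum>n<N. (norm (coeff (p * r) n))\<^sup>2)"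
    by (rule sum_mono2) (auto simp: N_def)
  moreover have "(\<Sum>n<N. (norm (coeff r n))\<^sup>2) = (\<Sum>n<L. (norm (coeff r n))\<^sup>2)"
    using r by (intro sum.mono_neutral_right) (auto simp: N_def coeff_eq_0)
  ultimately show ?thesis
    by simp
qed

definition partial_sum_poly :: "(nat \<Rightarrow> 'a::comm_semiring_1) \<Rightarrow> nat \<Rightarrow> 'a poly" where
  "partial_sum_poly b M = (\<Sum>n<M. monom (b n) n)"

lemma coeff_partial_sum_poly: "coeff (partial_sum_poly b M) n = (if n < M then b n else 0)"
  by (simp add: partial_sum_poly_def coeff_sum)

lemma degree_partial_sum_poly: "M > 0 \<Longrightarrow> degree (partial_sum_poly b M) < M"
  by (rule degree_lessI) (auto simp: coeff_partial_sum_poly)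

lemma poly_partial_sum_poly: "poly (partial_sum_poly b M) w = (\<Sum>n<M. b n * w ^ n)"
  by (simp add: partial_sum_poly_def poly_sum poly_monom)

lemma coeff_mult_partial_sum_poly:
  assumes "m < K" "K \<le> M"
  shows "coeff (partial_sum_poly b M * partial_sum_poly c K) m = (\<Sum>i\<le>m. b i * c (m - i))"
  unfolding coeff_mult using assms by (intro sum.cong) (auto simp: coeff_partial_sum_poly)

lemma norm_partial_sum_le_suminf_plus_tail:
  fixes f :: "nat \<Rightarrow> 'a::banach"
  assumes "summable (\<lambda>n. norm (f n))"
  shows "norm (\<Sum>n<M. f n) \<le> norm (\<Sum>n. f n) + (\<Sum>n. norm (f (n + M)))"
proof -
  have "(\<Sum>n<M. f n) = (\<Sum>n. f n) - (\<Sum>n. f (n + M))"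
    using suminf_split_initial_segment[OF summable_norm_cancel[OF assms], of M] by simp
  then have "norm (\<Sum>n<M. f n) \<le> norm (\<Sum>n. f n) + norm (\<Sum>n. f (n + M))"
    by (simp add: norm_triangle_ineq4)
  also have "norm (\<Sum>n. f (n + M)) \<le> (\<Sum>n. norm (f (n + M)))"
    using summable_ignore_initial_segment[OF assms] by (rule summable_norm)
  finally show ?thesis
    by simp
qed

lemma sum_norm_Cauchy_product_le_circle:
  fixes b c :: "nat \<Rightarrow> complex"
  assumes b: "summable (\<lambda>n. norm (b n))"
    and S: "\<And>w. norm w = 1 \<Longrightarrow> norm (\<Sum>n. b n * w ^ n) \<le> S"
  shows "(\<Sum>m<K. (norm (\<Sum>i\<le>m. b i * c (m - i)))\<^sup>2) \<le> S\<^sup>2 * (\<Sum>n<K. (norm (c n))\<^sup>2)"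
proof (cases "K = 0")
  case False
  define T where "T M = (\<Sum>n. norm (b (n + M)))" for M
  have "T \<longlonglongrightarrow> 0"
    unfolding T_def using b by (rule suminf_exist_split2)
  then have "(\<lambda>M. (S + T M)\<^sup>2 * (\<Sum>n<K. (norm (c n))\<^sup>2)) \<longlonglongrightarrow> S\<^sup>2 * (\<Sum>n<K. (norm (c n))\<^sup>2)"
    by (auto intro!: tendsto_eq_intros)
  then show ?thesis
  proof (rule LIMSEQ_le_const, intro exI allI impI)
    fix M assume M: "K \<le> M"
    have "norm (poly (partial_sum_poly b M) w) \<le> S + T M" if w: "norm w = 1" for w
    proof -
      have "norm (b n * w ^ n) = norm (b n)" for n
        by (simp add: norm_mult norm_power w)
      with norm_partial_sum_le_suminf_plus_tail[of "\<lambda>n. b n * w ^ n" M] S[OF w] b show ?thesis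
        by (simp add: poly_partial_sum_poly T_def)
    qed
    then have "(\<Sum>m<K. (norm (coeff (partial_sum_poly b M * partial_sum_poly c K) m))\<^sup>2)
        \<le> (S + T M)\<^sup>2 * (\<Sum>n<K. (norm (coeff (partial_sum_poly c K) n))\<^sup>2)"
      using False by (intro sum_norm_coeff_mult_le degree_partial_sum_poly) auto
    then show "(\<Sum>m<K. (norm (\<Sum>i\<le>m. b i * c (m - i)))\<^sup>2) \<le> (S + T M)\<^sup>2 * (\<Sum>n<K. (norm (c n))\<^sup>2)"
      using M by (simp add: coeff_mult_partial_sum_poly coeff_partial_sum_poly)
  qed
qed auto

lemma sum_norm_Cauchy_product_le:
  fixes b c :: "nat \<Rightarrow> complex"
  assumes b: "\<And>z. norm z < 1 \<Longrightarrow> summable (\<lambda>n. b n * z ^ n)"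
    and S: "\<And>z. norm z < 1 \<Longrightarrow> norm (\<Sum>n. b n * z ^ n) \<le> S"
  shows "(\<Sum>m<K. (norm (\<Sum>i\<le>m. b i * c (m - i)))\<^sup>2) \<le> S\<^sup>2 * (\<Sum>n<K. (norm (c n))\<^sup>2)"
proof (rule tendsto_upperbound)
  have "((\<lambda>r. \<Sum>m<K. (norm (\<Sum>i\<le>m. b i * of_real r ^ i * c (m - i)))\<^sup>2)
      \<longlongrightarrow> (\<Sum>m<K. (norm (\<Sum>i\<le>m. b i * of_real 1 ^ i * c (m - i)))\<^sup>2)) (at_left 1)"
    by (intro tendsto_intros)
  then show "((\<lambda>r. \<Sum>m<K. (norm (\<Sum>i\<le>m. b i * of_real r ^ i * c (m - i)))\<^sup>2)
      \<longlongrightarrow> (\<Sum>m<K. (norm (\<Sum>i\<le>m. b i * c (m - i)))\<^sup>2)) (at_left 1)"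
    by simp
  have "(\<Sum>m<K. (norm (\<Sum>i\<le>m. b i * of_real r ^ i * c (m - i)))\<^sup>2) \<le> S\<^sup>2 * (\<Sum>n<K. (norm (c n))\<^sup>2)"
    if r: "r \<in> {0<..<1}" for r :: real
  proof (rule sum_norm_Cauchy_product_le_circle)
    show "summable (\<lambda>n. norm (b n * of_real r ^ n))"
      using r by (intro summable_norm_power_series_unit_disc b) auto
    show "norm (\<Sum>n. b n * of_real r ^ n * w ^ n) \<le> S" if "norm w = 1" for w
      using S[of "of_real r * w"] r that by (simp add: norm_mult power_mult_distrib mult.assoc)
  qed
  then show "\<forall>\<^sub>F r in at_left (1 :: real).
      (\<Sum>m<K. (norm (\<Sum>i\<le>m. b i * of_real r ^ i * c (m - i)))\<^sup>2) \<le> S\<^sup>2 * (\<Sum>n<K. (norm (c n))\<^sup>2)"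
    by (rule eventually_at_leftI) auto
qed auto

subsection \<open>Sequence spaces\<close>

lemma lp_norm_nonneg: "0 \<le> lp_norm p g"
  by (simp add: lp_norm_def)

lemma sum_powr_le_lp_norm_powr:
  assumes "0 < p" "in_lp p g" "finite F"
  shows "(\<Sum>m\<in>F. norm (g m) powr p) \<le> lp_norm p g powr p"
proof -
  have "(\<Sum>m\<in>F. norm (g m) powr p) \<le> (\<Sum>\<^sub>\<infinity>m. norm (g m) powr p)"
    using assms by (intro finite_sum_le_infsum) (auto simp: in_lp_def)
  with assms(1) show ?thesis
    by (simp add: lp_norm_def powr_powr infsum_nonneg)
qed

lemma
  assumes "0 < p" "0 \<le> D" and F: "\<And>F. finite F \<Longrightarrow> (\<Sum>m\<in>F. norm (g m) powr p) \<le> D powr p"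
  shows in_lp_finite_sums: "in_lp p g" and lp_norm_le_finite_sums: "lp_norm p g \<le> D"
proof -
  have summable: "(\<lambda>m. norm (g m) powr p) summable_on UNIV"
    by (rule nonneg_bdd_above_summable_on) (auto intro!: bdd_aboveI2 F)
  then show "in_lp p g"
    by (simp add: in_lp_def)
  have "(\<Sum>\<^sub>\<infinity>m. norm (g m) powr p) \<le> D powr p"
    using summable F by (intro infsum_le_finite_sums) auto
  then have "lp_norm p g \<le> (D powr p) powr (1 / p)"
    unfolding lp_norm_def using assms(1) by (intro powr_mono2) (auto intro: infsum_nonneg)
  then show "lp_norm p g \<le> D"
    using assms(1,2) by (simp add: powr_powr)
qed

lemma
  assumes pq: "0 < p" "p \<le> q" and g: "in_lp p g"
  shows in_lp_mono: "in_lp q g" and lp_norm_antimono: "lp_norm q g \<le> lp_norm p g"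
proof -
  define N where "N = lp_norm p g"
  have sum_le: "(\<Sum>m\<in>F. norm (g m) powr p) \<le> N powr p" if "finite F" for F
    unfolding N_def using pq(1) g that by (rule sum_powr_le_lp_norm_powr)
  have le: "norm (g m) \<le> N" for m
    using sum_le[of "{m}"] powr_less_mono2[of p N "norm (g m)"] pq lp_norm_nonneg[of p g]
    by (force simp: N_def not_le[symmetric])
  have "(\<Sum>m\<in>F. norm (g m) powr q) \<le> N powr q" if "finite F" for F
  proof -
    have "(\<Sum>m\<in>F. norm (g m) powr q) = (\<Sum>m\<in>F. norm (g m) powr p * norm (g m) powr (q - p))"
      by (simp flip: powr_add)
    also have "\<dots> \<le> (\<Sum>m\<in>F. norm (g m) powr p * N powr (q - p))"
      using pq le by (intro sum_mono mult_left_mono powr_mono2) auto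
    also have "\<dots> \<le> N powr p * N powr (q - p)"
      unfolding sum_distrib_right[symmetric] by (intro mult_right_mono sum_le that) auto
    finally show ?thesis
      by (simp flip: powr_add)
  qed
  then show "in_lp q g" "lp_norm q g \<le> lp_norm p g"
    unfolding N_def using pq in_lp_finite_sums[of q "lp_norm p g" g] lp_norm_le_finite_sums[of q "lp_norm p g" g] lp_norm_nonneg by auto
qed

subsection \<open>Convolution on the integers\<close>

definition convolve :: "(nat \<Rightarrow> complex) \<Rightarrow> (int \<Rightarrow> complex) \<Rightarrow> int \<Rightarrow> complex" where
  "convolve b g m = (\<Sum>n. b n * g (m - int n))"

lemma sum_norm_square_le_lp_norm:
  assumes "in_lp 2 g" "finite F"
  shows "(\<Sum>m\<in>F. (norm (g m))\<^sup>2) \<le> (lp_norm 2 g)\<^sup>2"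
  using sum_powr_le_lp_norm_powr[OF _ assms] lp_norm_nonneg[of 2 g] by simp

lemma sum_norm_square_reindex_le_lp_norm:
  assumes "in_lp 2 g" "finite F" "inj_on f F"
  shows "(\<Sum>n\<in>F. (norm (g (f n)))\<^sup>2) \<le> (lp_norm 2 g)\<^sup>2"
  using sum_norm_square_le_lp_norm[OF assms(1), of "f ` F"] assms by (simp add: sum.reindex)

lemma summable_mult_square_summable:
  fixes f g :: "nat \<Rightarrow> 'a::{real_normed_algebra, banach}"
  assumes "summable (\<lambda>n. (norm (f n))\<^sup>2)" "summable (\<lambda>n. (norm (g n))\<^sup>2)"
  shows "summable (\<lambda>n. f n * g n)"
proof (rule summable_comparison_test')
  show "summable (\<lambda>n. (norm (f n))\<^sup>2 + (norm (g n))\<^sup>2)"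
    using assms by (rule summable_add)
  show "norm (f n * g n) \<le> (norm (f n))\<^sup>2 + (norm (g n))\<^sup>2" if "0 \<le> n" for n
  proof -
    have "norm (f n * g n) \<le> norm (f n) * norm (g n)"
      by (rule norm_mult_ineq)
    also have "\<dots> \<le> 2 * norm (f n) * norm (g n)"
      by simp
    also have "\<dots> \<le> (norm (f n))\<^sup>2 + (norm (g n))\<^sup>2"
      by (rule sum_squares_bound)
    finally show ?thesis .
  qed
qed

lemma summable_square_coeffs_bounded_power_series:
  fixes b :: "nat \<Rightarrow> complex"
  assumes "\<And>z. norm z < 1 \<Longrightarrow> summable (\<lambda>n. b n * z ^ n)"
    and "\<And>z. norm z < 1 \<Longrightarrow> norm (\<Sum>n. b n * z ^ n) \<le> S"
  shows "summable (\<lambda>n. (norm (b n))\<^sup>2)"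
proof (rule summableI_nonneg_bounded)
  fix K
  define \<delta> :: "nat \<Rightarrow> complex" where "\<delta> n = (if n = 0 then 1 else 0)" for n
  have "(\<Sum>i\<le>n. b i * \<delta> (n - i)) = (\<Sum>i\<le>n. if i = n then b i else 0)" for n
    by (intro sum.cong) (auto simp: \<delta>_def)
  then have "(\<Sum>n<K. (norm (b n))\<^sup>2) \<le> S\<^sup>2 * (\<Sum>n<K. (norm (\<delta> n))\<^sup>2)"
    using sum_norm_Cauchy_product_le[OF assms, where c = \<delta> and K = K] by simp
  also have "(\<Sum>n<K. (norm (\<delta> n))\<^sup>2) = (\<Sum>n<K. if n = 0 then 1 else 0)"
    by (intro sum.cong) (auto simp: \<delta>_def)
  also have "S\<^sup>2 * \<dots> \<le> S\<^sup>2 * 1"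
    by (intro mult_left_mono) auto
  finally show "(\<Sum>n<K. (norm (b n))\<^sup>2) \<le> S\<^sup>2"
    by simp
qed auto

lemma summable_convolve:
  assumes "\<And>z. norm z < 1 \<Longrightarrow> summable (\<lambda>n. b n * z ^ n)"
    and "\<And>z. norm z < 1 \<Longrightarrow> norm (\<Sum>n. b n * z ^ n) \<le> S" and g: "in_lp 2 g"
  shows "summable (\<lambda>n. b n * g (m - int n))"
proof (rule summable_mult_square_summable)
  show "summable (\<lambda>n. (norm (b n))\<^sup>2)"
    using assms(1,2) by (rule summable_square_coeffs_bounded_power_series)
  show "summable (\<lambda>n. (norm (g (m - int n)))\<^sup>2)"
    by (rule summableI_nonneg_bounded) (auto intro!: sum_norm_square_reindex_le_lp_norm g simp: inj_on_def)
qed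

lemma sum_norm_truncated_convolution_le:
  assumes b: "\<And>z. norm z < 1 \<Longrightarrow> summable (\<lambda>n. b n * z ^ n)"
    and S: "\<And>z. norm z < 1 \<Longrightarrow> norm (\<Sum>n. b n * z ^ n) \<le> S" and g: "in_lp 2 g"
    and F: "finite F" "F \<subseteq> {- int L..int L}"
  shows "(\<Sum>m\<in>F. (norm (\<Sum>i\<le>nat (m + int L). b i * g (m - int i)))\<^sup>2) \<le> (S * lp_norm 2 g)\<^sup>2"
proof -
  define c where "c n = g (int n - int L)" for n
  define K where "K = Suc (2 * L)"
  have "(\<Sum>i\<le>nat (m + int L). b i * g (m - int i)) = (\<Sum>i\<le>nat (m + int L). b i * c (nat (m + int L) - i))"
    if "m \<in> F" for m
    unfolding c_def using that F(2) by (intro sum.cong) auto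
  then have "(\<Sum>m\<in>F. (norm (\<Sum>i\<le>nat (m + int L). b i * g (m - int i)))\<^sup>2)
      = (\<Sum>k\<in>(\<lambda>m. nat (m + int L)) ` F. (norm (\<Sum>i\<le>k. b i * c (k - i)))\<^sup>2)"
    using F(2) by (subst sum.reindex) (auto simp: inj_on_def nat_eq_iff intro!: sum.cong)
  also have "\<dots> \<le> (\<Sum>k<K. (norm (\<Sum>i\<le>k. b i * c (k - i)))\<^sup>2)"
    using F(2) by (intro sum_mono2) (fastforce simp: K_def nat_less_iff)+
  also have "\<dots> \<le> S\<^sup>2 * (\<Sum>n<K. (norm (c n))\<^sup>2)"
    by (rule sum_norm_Cauchy_product_le[OF b S])
  also have "\<dots> \<le> S\<^sup>2 * (lp_norm 2 g)\<^sup>2"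
    unfolding c_def by (intro mult_left_mono sum_norm_square_reindex_le_lp_norm g) (auto simp: inj_on_def)
  finally show ?thesis
    by (simp add: power_mult_distrib)
qed

lemma
  assumes b: "\<And>z. norm z < 1 \<Longrightarrow> summable (\<lambda>n. b n * z ^ n)"
    and S: "\<And>z. norm z < 1 \<Longrightarrow> norm (\<Sum>n. b n * z ^ n) \<le> S" and g: "in_lp 2 g"
  shows in_lp_convolve: "in_lp 2 (convolve b g)"
    and lp_norm_convolve_le: "lp_norm 2 (convolve b g) \<le> S * lp_norm 2 g"
proof -
  define u where "u L m = (\<Sum>i\<le>nat (m + int L). b i * g (m - int i))" for L m
  have u_lim: "(\<lambda>L. u L m) \<longlonglongrightarrow> convolve b g m" for m
  proof -
    have "filterlim (\<lambda>L. nat (m + int L)) at_top sequentially"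
      by (rule filterlim_at_top_mono[OF filterlim_minus_const_nat_at_top[of "nat \<bar>m\<bar>"] always_eventually])
        auto
    from filterlim_compose[OF summable_LIMSEQ'[OF summable_convolve[OF b S g]] this] show ?thesis
      by (simp only: u_def convolve_def)
  qed
  have "(\<Sum>m\<in>F. (norm (convolve b g m))\<^sup>2) \<le> (S * lp_norm 2 g)\<^sup>2" if F: "finite F" for F
  proof (rule LIMSEQ_le_const2)
    show "(\<lambda>L. \<Sum>m\<in>F. (norm (u L m))\<^sup>2) \<longlonglongrightarrow> (\<Sum>m\<in>F. (norm (convolve b g m))\<^sup>2)"
      by (intro tendsto_intros u_lim)
    have "F \<subseteq> {- int L..int L}" if "nat (\<Sum>m\<in>F. \<bar>m\<bar>) \<le> L" for L
      using member_le_sum[of _ F abs] F that by fastforce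
    then show "\<exists>L0. \<forall>L\<ge>L0. (\<Sum>m\<in>F. (norm (u L m))\<^sup>2) \<le> (S * lp_norm 2 g)\<^sup>2"
      unfolding u_def using sum_norm_truncated_convolution_le[OF b S g F] by blast
  qed
  moreover have "0 \<le> S"
    using order.trans[OF norm_ge_zero S[of 0]] by simp
  ultimately show "in_lp 2 (convolve b g)" "lp_norm 2 (convolve b g) \<le> S * lp_norm 2 g"
    using in_lp_finite_sums[of 2 "S * lp_norm 2 g" "convolve b g"]
      lp_norm_le_finite_sums[of 2 "S * lp_norm 2 g" "convolve b g"] lp_norm_nonneg[of 2 g] by auto
qed

subsection \<open>Boundedness of the fractional integral operator\<close>

lemma I_sf_eq_convolve: "I_sf s g = convolve (frac_integral s (\<lambda>n. of_int (euler_coeff n))) g"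
proof
  fix m
  let ?f = "\<lambda>n. frac_integral s (\<lambda>n. of_int (euler_coeff n)) n * g (m - int n)"
  have "(\<lambda>n. ?f (Suc n)) sums x \<longleftrightarrow> ?f sums x" for x
    using sums_Suc_iff[of ?f x] by simp
  then have "(\<Sum>n. ?f (Suc n)) = (\<Sum>n. ?f n)"
    by (simp only: suminf_def)
  then show "I_sf s g m = convolve (frac_integral s (\<lambda>n. of_int (euler_coeff n))) g m"
    by (simp add: I_sf_def convolve_def frac_integral_def)
qed

lemma I_sf_l2_bounded:
  assumes "1 / 4 < s"
  obtains C where "0 \<le> C" "\<And>g. in_lp 2 g \<Longrightarrow> in_lp 2 (I_sf s g)"
    "\<And>g. in_lp 2 g \<Longrightarrow> lp_norm 2 (I_sf s g) \<le> C * lp_norm 2 g"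
proof -
  let ?a = "\<lambda>n. of_int (euler_coeff n) :: complex"
  have summable: "summable (\<lambda>n. ?a n * z ^ n)" if "norm z < 1" for z
    using euler_coeff_sums[OF that] by (rule sums_summable)
  have growth: "norm (\<Sum>n. ?a n * z ^ n) \<le> (8 * exp 5) powr (1 / 4) * (1 - norm z) powr (- (1 / 4))"
    if "norm z < 1" for z
    using norm_qprod_diagonal_le[OF that] sums_unique[OF euler_coeff_sums[OF that]] by simp
  obtain C where C: "\<And>z. norm z < 1 \<Longrightarrow> norm (\<Sum>n. frac_integral s ?a n * z ^ n) \<le> C"
    using frac_integral_bounded[where c = ?a, OF _ assms summable growth] by auto
  have summable_frac: "summable (\<lambda>n. frac_integral s ?a n * z ^ n)" if "norm z < 1" for z
    using assms summable that
    by (intro summable_norm_cancel[OF summable_norm_frac_integral] summable_norm_power_series_unit_disc) auto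
  show thesis
  proof
    show "0 \<le> C"
      using order.trans[OF norm_ge_zero C[of 0]] by simp
  next
    fix g assume g: "in_lp 2 g"
    show "in_lp 2 (I_sf s g)"
      unfolding I_sf_eq_convolve using summable_frac C g by (rule in_lp_convolve)
    show "lp_norm 2 (I_sf s g) \<le> C * lp_norm 2 g"
      unfolding I_sf_eq_convolve using summable_frac C g by (rule lp_norm_convolve_le)
  qed
qed

theorem theorem4:
  fixes s p q :: real
  assumes "1/4 < s" "s < 1/2"
    and "1 < p" "p \<le> 2" "2 \<le> q"
    and "1 / q \<le> 1 / p - 1/2 + s"
  shows "\<exists>C. \<forall>g. in_lp p g \<longrightarrow> in_lp q (I_sf s g) \<and> lp_norm q (I_sf s g) \<le> C * lp_norm p g"
proof -
  obtain C where C: "0 \<le> C" "\<And>g. in_lp 2 g \<Longrightarrow> in_lp 2 (I_sf s g)"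
    "\<And>g. in_lp 2 g \<Longrightarrow> lp_norm 2 (I_sf s g) \<le> C * lp_norm 2 g"
    using I_sf_l2_bounded[OF assms(1)] by blast
  have "in_lp q (I_sf s g) \<and> lp_norm q (I_sf s g) \<le> C * lp_norm p g" if "in_lp p g" for g
  proof
    have g: "in_lp 2 g" "lp_norm 2 g \<le> lp_norm p g"
      using in_lp_mono[of p 2 g] lp_norm_antimono[of p 2 g] assms(3,4) that by auto
    show "in_lp q (I_sf s g)"
      using in_lp_mono[of 2 q] assms(5) C(2)[OF g(1)] by simp
    have "lp_norm q (I_sf s g) \<le> lp_norm 2 (I_sf s g)"
      using assms(5) C(2)[OF g(1)] by (intro lp_norm_antimono) auto
    also have "\<dots> \<le> C * lp_norm 2 g"
      by (rule C(3)[OF g(1)])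
    also have "\<dots> \<le> C * lp_norm p g"
      using C(1) g(2) by (intro mult_left_mono)
    finally show "lp_norm q (I_sf s g) \<le> C * lp_norm p g" .
  qed
  then show ?thesis
    by blast
qed

end
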